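(* For $\mu\in\overline{\mathbb{F}}_2$ let $$S_\mu=\{s_1=s_4+\mu s_2^2=0\}\subset\mathbb{P}^4,$$ where $s_i$ denotes the elementary symmetric polynomial of degree $i$ in the homogeneous coordinates $x_1,\dots,x_5$ of $\mathbb{P}^4$; view $S_\mu$ as a quartic surface in the hyperplane $\{s_1=0\}\cong\mathbb{P}^3$. Let $\alpha\in\mathbb{F}_{16}$ satisfy $\alpha^4+\alpha^3+\alpha^2+\alpha+1=0$ and put $\mu_0=1+\alpha^2+\alpha^3$. Then $\mu_0$ is a primitive third root of unity (so $S_{\mu_0}$ is defined over $\mathbb{F}_4$), the quartic surface $S_{\mu_0}$ is smooth, it contains the line $$\ell=\{s_1=x_3+x_2+(\alpha^3+\alpha+1)x_1=x_4+(\alpha^3+\alpha^2+\alpha+1)x_2+\alpha x_1=0\},$$ and the orbit of $\ell$ under the symmetric group $S_5$ permuting the coordinates $x_1,\dots,x_5$ consists of exactly $60$ lines. In particular there is a smooth quartic surface defined over $\mathbb{F}_4$ which contains $60$ lines defined over $\mathbb{F}_{16}$. *)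

theory Defs
  imports
    "HOL-Analysis.Cartesian_Space"
    "HOL-Library.Numeral_Type"
    "HOL-Library.Poly_Mapping"
    "HOL-Library.Z2"
    "HOL-Algebra.Algebraic_Closure_Type"
    "HOL-Algebra.Group_Action"
begin

section \<open>Coefficient fields\<close>

type_synonym F2bar = "bit alg_closure"

text \<open>For a power \<open>q\<close> of 2 this is the unique subfield with \<open>q\<close> elements.\<close>

definition Fq :: "nat \<Rightarrow> F2bar set" where
  "Fq q = {x. x ^ q = x}"

definition primitive_root_of_unity :: "nat \<Rightarrow> 'k::comm_ring_1 \<Rightarrow> bool" where
  "primitive_root_of_unity n z \<longleftrightarrow> 0 < n \<and> z ^ n = 1 \<and> (\<forall>k. 0 < k \<and> k < n \<longrightarrow> z ^ k \<noteq> 1)"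


section \<open>Polynomials in variables indexed by a finite type\<close>

text \<open>The coordinates \<open>x\<^sub>1, \<dots>, x\<^sub>5\<close> are indexed by the numeral type \<open>5\<close>, whose
  elements are \<open>1, 2, 3, 4\<close> and \<open>5 = 0\<close>; likewise for the index type \<open>4\<close>.\<close>

type_synonym ('n, 'k) mpoly = "('n \<Rightarrow>\<^sub>0 nat) \<Rightarrow>\<^sub>0 'k"

definition Var :: "'n \<Rightarrow> ('n, 'k::comm_ring_1) mpoly" where
  "Var i = Poly_Mapping.single (Poly_Mapping.single i 1) 1"

definition Cst :: "'k \<Rightarrow> ('n, 'k::comm_ring_1) mpoly" where
  "Cst c = Poly_Mapping.single 0 c"

definition mpoly_eval :: "('n::finite, 'k::comm_ring_1) mpoly \<Rightarrow> 'k ^ 'n \<Rightarrow> 'k" where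
  "mpoly_eval p v =
     (\<Sum>m\<in>Poly_Mapping.keys p. Poly_Mapping.lookup p m * (\<Prod>i\<in>UNIV. (v $ i) ^ Poly_Mapping.lookup m i))"

definition mpoly_subst ::
    "('n \<Rightarrow> ('m, 'k) mpoly) \<Rightarrow> ('n::finite, 'k::comm_ring_1) mpoly \<Rightarrow> ('m, 'k) mpoly" where
  "mpoly_subst g p =
     (\<Sum>m\<in>Poly_Mapping.keys p. Cst (Poly_Mapping.lookup p m) * (\<Prod>i\<in>UNIV. g i ^ Poly_Mapping.lookup m i))"

text \<open>The truncated exponent subtraction is harmless: if \<open>i\<close> does not occur in \<open>m\<close>, the
  coefficient is zero.\<close>

definition partial_deriv :: "'n \<Rightarrow> ('n, 'k::comm_ring_1) mpoly \<Rightarrow> ('n, 'k) mpoly" where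
  "partial_deriv i p =
     (\<Sum>m\<in>Poly_Mapping.keys p. Poly_Mapping.single (m - Poly_Mapping.single i 1)
        (of_nat (Poly_Mapping.lookup m i) * Poly_Mapping.lookup p m))"

definition gradient :: "('n::finite, 'k::comm_ring_1) mpoly \<Rightarrow> 'k ^ 'n \<Rightarrow> 'k ^ 'n" where
  "gradient p v = (\<chi> i. mpoly_eval (partial_deriv i p) v)"

definition homogeneous :: "nat \<Rightarrow> ('n::finite, 'k::zero) mpoly \<Rightarrow> bool" where
  "homogeneous d p \<longleftrightarrow> (\<forall>m\<in>Poly_Mapping.keys p. (\<Sum>i\<in>UNIV. Poly_Mapping.lookup m i) = d)"

definition coeffs_in :: "'k set \<Rightarrow> ('n, 'k::zero) mpoly \<Rightarrow> bool" where
  "coeffs_in K p \<longleftrightarrow> (\<forall>m. Poly_Mapping.lookup p m \<in> K)"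

definition elem_sym :: "nat \<Rightarrow> ('n::finite, 'k::comm_ring_1) mpoly" where
  "elem_sym d = (\<Sum>A | card A = d. \<Prod>i\<in>A. Var i)"


section \<open>Projective space\<close>

text \<open>Linear algebra on \<open>'k ^ 'n\<close> over an arbitrary field is the library interpretation \<open>vec\<close>.
  A point of projective space is a one-dimensional subspace of \<open>'k ^ 'n\<close>, so the projective
  dimension is \<open>CARD('n) - 1\<close>.\<close>

definition proj_space :: "('k::field ^ 'n::finite) set set" where
  "proj_space = {P. vec.subspace P \<and> vec.dim P = 1}"

definition zero_locus :: "('n::finite, 'k::field) mpoly set \<Rightarrow> ('k ^ 'n) set set" where
  "zero_locus F = {P \<in> proj_space. \<forall>p\<in>F. \<forall>v\<in>P. mpoly_eval p v = 0}"

definition is_line :: "('k::field ^ 'n::finite) set set \<Rightarrow> bool" where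
  "is_line L \<longleftrightarrow> (\<exists>W. vec.subspace W \<and> vec.dim W = 2 \<and> L = {P \<in> proj_space. P \<subseteq> W})"

definition line_over :: "'k set \<Rightarrow> ('k::field ^ 'n::finite) set set \<Rightarrow> bool" where
  "line_over K L \<longleftrightarrow> is_line L \<and>
     (\<exists>F. (\<forall>p\<in>F. homogeneous 1 p \<and> coeffs_in K p) \<and> L = zero_locus F)"

text \<open>The Jacobian criterion for the closed subscheme of projective space cut out by a finite set
  \<open>F\<close> of homogeneous polynomials over an algebraically closed field: it is smooth of pure
  dimension \<open>d\<close> if the Jacobian matrix has rank equal to the codimension at every point.\<close>

definition smooth_of_dim :: "nat \<Rightarrow> ('n::finite, 'k::alg_closed_field) mpoly set \<Rightarrow> bool" where
  "smooth_of_dim d F \<longleftrightarrow>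
     (\<forall>P\<in>zero_locus F. \<forall>v\<in>P. v \<noteq> 0 \<longrightarrow>
        vec.dim ((\<lambda>p. gradient p v) ` F) + d + 1 = CARD('n))"

definition smooth_quartic_surface :: "(4, 'k::alg_closed_field) mpoly \<Rightarrow> bool" where
  "smooth_quartic_surface f \<longleftrightarrow> f \<noteq> 0 \<and> homogeneous 4 f \<and> smooth_of_dim 2 {f}"

text \<open>The left action of the symmetric group on points and on sets of points: the \<open>i\<close>-th
  coordinate is moved to position \<open>\<sigma> i\<close>.\<close>

definition permute_coords :: "('n \<Rightarrow> 'n) \<Rightarrow> 'k ^ 'n::finite \<Rightarrow> 'k ^ 'n" where
  "permute_coords \<sigma> v = (\<chi> i. v $ inv_into UNIV \<sigma> i)"

definition permute_points :: "('n \<Rightarrow> 'n) \<Rightarrow> ('k ^ 'n::finite) set set \<Rightarrow> ('k ^ 'n) set set" where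
  "permute_points \<sigma> L = (\<lambda>P. permute_coords \<sigma> ` P) ` L"


section \<open>The surfaces and the line\<close>

definition S_quartic :: "F2bar \<Rightarrow> (5, F2bar) mpoly" where
  "S_quartic \<mu> = elem_sym 4 + Cst \<mu> * elem_sym 2 ^ 2"

definition S_eqs :: "F2bar \<Rightarrow> (5, F2bar) mpoly set" where
  "S_eqs \<mu> = {elem_sym 1, S_quartic \<mu>}"

definition S_surface :: "F2bar \<Rightarrow> (F2bar ^ 5) set set" where
  "S_surface \<mu> = zero_locus (S_eqs \<mu>)"

text \<open>The identification of the hyperplane \<open>s\<^sub>1 = 0\<close> with projective 3-space by the coordinates
  \<open>x\<^sub>1, \<dots>, x\<^sub>4\<close>, and the equation of the quartic surface in these coordinates.\<close>

definition hyperplane_coords :: "5 \<Rightarrow> (4, F2bar) mpoly" where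
  "hyperplane_coords i =
     (if i = 1 then Var 1 else if i = 2 then Var 2 else if i = 3 then Var 3 else if i = 4 then Var 4
      else - (Var 1 + Var 2 + Var 3 + Var 4))"

definition S_quartic_P3 :: "F2bar \<Rightarrow> (4, F2bar) mpoly" where
  "S_quartic_P3 \<mu> = mpoly_subst hyperplane_coords (S_quartic \<mu>)"

definition line_l :: "F2bar \<Rightarrow> (F2bar ^ 5) set set" where
  "line_l \<alpha> = zero_locus
     {elem_sym 1,
      Var 3 + Var 2 + Cst (\<alpha> ^ 3 + \<alpha> + 1) * Var 1,
      Var 4 + Cst (\<alpha> ^ 3 + \<alpha> ^ 2 + \<alpha> + 1) * Var 2 + Cst \<alpha> * Var 1}"

definition line_orbit :: "F2bar \<Rightarrow> (F2bar ^ 5) set set set" where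
  "line_orbit \<alpha> = orbit (BijGroup (UNIV :: 5 set)) permute_points (line_l \<alpha>)"

end

theory Submission
  imports Defs "HOL-Combinatorics.Permutations"
begin

text \<open>In characteristic two the square \<open>s\<^sub>2\<^sup>2\<close> has zero gradient, so a singular point of \<open>S\<^sub>\<mu>\<close> is a
  point where all \<open>\<partial>\<^sub>i s\<^sub>4\<close> agree. Since \<open>\<partial>\<^sub>i s\<^sub>4 - \<partial>\<^sub>j s\<^sub>4 = (x\<^sub>j - x\<^sub>i) e\<^sub>2(other three)\<close>, two of its
  coordinates coincide, and then \<open>s\<^sub>1 = 0\<close> and \<open>s\<^sub>4 + \<mu> s\<^sub>2\<^sup>2 = 0\<close> with \<open>\<mu> \<noteq> 0\<close> force all of them to vanish.
  The stabilizer of \<open>\<ell>\<close> in \<open>S\<^sub>5\<close> consists of the identity and the double transposition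
  \<open>(2 3)(4 5)\<close>, so the orbit has \<open>120 / 2 = 60\<close> elements. Projecting away from \<open>x\<^sub>5\<close> identifies
  the hyperplane \<open>s\<^sub>1 = 0\<close> with \<open>P\<^sup>3\<close>.\<close>

\<comment> \<open>Otherwise each \<open>$\<close> parses in two ways, and terms with many components in exponentially many.\<close>
no_notation fps_nth (infixl \<open>$\<close> 75)

section \<open>Polynomial mappings\<close>

text \<open>Five coordinates keep the S_5 symmetry visible: elementary symmetric polynomials are
  invariant, so checking the single line \<ell> settles its whole orbit. Four coordinates are what a
  quartic surface in P^3 requires. Both Jacobian criteria reduce to the same pointwise statement
  \<open>singular_point_eq_0\<close>: in P^4 the gradient of s_1 is the all-ones vector, so the rank
  drops exactly when the gradient of s_4 is constant; in P^3 the chain rule with x_5 = -(x_1 + x_2 +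
  x_3 + x_4) turns each partial derivative into a difference with the fifth one.

  The obstacle for the stabilizer is that \<alpha> is an abstract root in an algebraic closure. Its
  powers reduce to degree below 4, which proves identities, but excluding the other permutations
  needs inequalities, hence the linear independence of 1, \<alpha>, \<alpha>^2, \<alpha>^3 over F_2.
  This comes from a finite check that the 16 coefficient vectors form a field.\<close>

lemma sum_keys_add:
  fixes h :: "'a \<Rightarrow> 'b::comm_monoid_add \<Rightarrow> 'c::comm_monoid_add"
  assumes h0: "\<And>m. h m 0 = 0" and hadd: "\<And>m a b. h m (a + b) = h m a + h m b"
  shows "(\<Sum>m\<in>Poly_Mapping.keys (p + q). h m (Poly_Mapping.lookup (p + q) m)) =
    (\<Sum>m\<in>Poly_Mapping.keys p. h m (Poly_Mapping.lookup p m)) +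
    (\<Sum>m\<in>Poly_Mapping.keys q. h m (Poly_Mapping.lookup q m))"
proof -
  \<comment> \<open>Cancellation can make the keys of \<open>p + q\<close> fewer than this union; by
    \<open>h0\<close> the extra indices contribute 0, so all three sums can run over it.\<close>
  let ?A = "Poly_Mapping.keys p \<union> Poly_Mapping.keys q"
  have *: "(\<Sum>m\<in>Poly_Mapping.keys r. h m (Poly_Mapping.lookup r m)) =
      (\<Sum>m\<in>?A. h m (Poly_Mapping.lookup r m))" if "Poly_Mapping.keys r \<subseteq> ?A" for r
    using that by (intro sum.mono_neutral_left) (auto simp: h0 in_keys_iff)
  show ?thesis
    unfolding *[OF keys_add] *[OF Un_upper1] *[OF Un_upper2] by (simp add: lookup_add hadd sum.distrib)
qed

lemma sum_keys_single:
  fixes h :: "'a \<Rightarrow> 'b::comm_monoid_add \<Rightarrow> 'c::comm_monoid_add"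
  assumes "\<And>m. h m 0 = 0"
  shows "(\<Sum>n\<in>Poly_Mapping.keys (Poly_Mapping.single m c).
    h n (Poly_Mapping.lookup (Poly_Mapping.single m c) n)) = h m c"
  by (cases "c = 0") (auto simp: assms)

text \<open>Evaluation, substitution and derivation are additive, so identities between them need
  checking on monomials only; product rules use this induction twice, once per factor.\<close>

lemma poly_mapping_induct [case_names single add]:
  assumes single: "\<And>m c. P (Poly_Mapping.single m c)"
    and add: "\<And>p q. P p \<Longrightarrow> P q \<Longrightarrow> P (p + q)"
  shows "P (p :: 'a \<Rightarrow>\<^sub>0 'b::comm_monoid_add)"
proof -
  have "P (\<Sum>m\<in>A. Poly_Mapping.single m (Poly_Mapping.lookup p m))" if "finite A" for A
    using that
  proof induction
    case empty
    show ?case using single[of undefined 0] by simp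
  next
    case (insert m A)
    then show ?case by (simp add: single add)
  qed
  moreover have "p = (\<Sum>m\<in>Poly_Mapping.keys p. Poly_Mapping.single m (Poly_Mapping.lookup p m))"
    by (rule poly_mapping_eqI)
      (auto simp: lookup_sum lookup_single when_def sum.delta in_keys_iff)
  ultimately show ?thesis by (metis finite_keys)
qed

section \<open>Evaluation, substitution and derivation\<close>

lemma mpoly_eval_single:
  "mpoly_eval (Poly_Mapping.single m c) v = c * (\<Prod>i\<in>UNIV. (v $ i) ^ Poly_Mapping.lookup m i)"
  unfolding mpoly_eval_def
  by (rule sum_keys_single[where h = "\<lambda>m c. c * (\<Prod>i\<in>UNIV. (v $ i) ^ Poly_Mapping.lookup m i)"]) simp

lemma mpoly_eval_add: "mpoly_eval (p + q) v = mpoly_eval p v + mpoly_eval q v"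
  unfolding mpoly_eval_def
  by (rule sum_keys_add[where h = "\<lambda>m c. c * (\<Prod>i\<in>UNIV. (v $ i) ^ Poly_Mapping.lookup m i)"])
    (simp_all add: algebra_simps)

lemma mpoly_eval_mult: "mpoly_eval (p * q) v = mpoly_eval p v * mpoly_eval q v"
proof (induction p rule: poly_mapping_induct)
  case (single m c)
  show ?case
    by (induction q rule: poly_mapping_induct)
      (simp_all add: mult_single mpoly_eval_single mpoly_eval_add lookup_add power_add
        prod.distrib algebra_simps)
qed (simp add: mpoly_eval_add algebra_simps)

lemma mpoly_eval_Cst [simp]: "mpoly_eval (Cst c) v = c"
  by (simp add: Cst_def mpoly_eval_single)

lemma mpoly_eval_0 [simp]: "mpoly_eval 0 v = 0"
  by (simp add: mpoly_eval_def)

lemma mpoly_eval_1 [simp]: "mpoly_eval 1 v = 1"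
  using mpoly_eval_Cst[of 1 v] by (simp add: Cst_def)

lemma mpoly_eval_Var [simp]: "mpoly_eval (Var j) v = v $ j"
proof -
  have "(\<Prod>i\<in>UNIV. (v $ i) ^ Poly_Mapping.lookup (Poly_Mapping.single j 1) i) =
      (\<Prod>i\<in>UNIV. if i = j then v $ i else 1)"
    by (intro prod.cong) (auto simp: lookup_single when_def)
  then show ?thesis by (simp add: Var_def mpoly_eval_single)
qed

lemma mpoly_eval_uminus: "mpoly_eval (- p) v = - mpoly_eval p v"
  using mpoly_eval_add[of p "- p" v] by (simp add: minus_unique)

lemma mpoly_eval_power: "mpoly_eval (p ^ n) v = mpoly_eval p v ^ n"
  by (induction n) (simp_all add: mpoly_eval_mult)

lemma mpoly_eval_prod: "mpoly_eval (\<Prod>i\<in>A. f i) v = (\<Prod>i\<in>A. mpoly_eval (f i) v)"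
  by (induction A rule: infinite_finite_induct) (simp_all add: mpoly_eval_mult)

lemmas mpoly_eval_simps = mpoly_eval_add mpoly_eval_mult mpoly_eval_uminus mpoly_eval_power

lemma Cst_add: "Cst (a + b) = Cst a + Cst b"
  by (simp add: Cst_def single_add)

lemma Cst_mult: "Cst (a * b) = Cst a * Cst b"
  by (simp add: Cst_def mult_single)

lemma Cst_0 [simp]: "Cst 0 = 0"
  by (simp add: Cst_def)

lemma Cst_1 [simp]: "Cst 1 = 1"
  by (simp add: Cst_def)

lemma mpoly_subst_single:
  "mpoly_subst g (Poly_Mapping.single m c) = Cst c * (\<Prod>i\<in>UNIV. g i ^ Poly_Mapping.lookup m i)"
  unfolding mpoly_subst_def
  by (rule sum_keys_single[where h = "\<lambda>m c. Cst c * (\<Prod>i\<in>UNIV. g i ^ Poly_Mapping.lookup m i)"]) simp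

lemma mpoly_subst_add: "mpoly_subst g (p + q) = mpoly_subst g p + mpoly_subst g q"
  unfolding mpoly_subst_def
  by (rule sum_keys_add[where h = "\<lambda>m c. Cst c * (\<Prod>i\<in>UNIV. g i ^ Poly_Mapping.lookup m i)"])
    (simp_all add: Cst_add algebra_simps)

lemma mpoly_subst_mult: "mpoly_subst g (p * q) = mpoly_subst g p * mpoly_subst g q"
proof (induction p rule: poly_mapping_induct)
  case (single m c)
  show ?case
    by (induction q rule: poly_mapping_induct)
      (simp_all add: mult_single mpoly_subst_single mpoly_subst_add lookup_add power_add
        prod.distrib Cst_mult algebra_simps)
qed (simp add: mpoly_subst_add algebra_simps)

lemma mpoly_subst_Cst [simp]: "mpoly_subst g (Cst c) = Cst c"
  by (simp add: Cst_def mpoly_subst_single)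

lemma mpoly_subst_1 [simp]: "mpoly_subst g 1 = 1"
  using mpoly_subst_Cst[of g 1] by simp

lemma mpoly_subst_Var [simp]: "mpoly_subst g (Var j) = g j"
proof -
  have "(\<Prod>i\<in>UNIV. g i ^ Poly_Mapping.lookup (Poly_Mapping.single j 1) i) =
      (\<Prod>i\<in>UNIV. if i = j then g i else 1)"
    by (intro prod.cong) (auto simp: lookup_single when_def)
  then show ?thesis by (simp add: Var_def mpoly_subst_single)
qed

lemma mpoly_subst_power: "mpoly_subst g (p ^ n) = mpoly_subst g p ^ n"
  by (induction n) (simp_all add: mpoly_subst_mult)

lemma mpoly_eval_subst:
  "mpoly_eval (mpoly_subst g p) v = mpoly_eval p (\<chi> i. mpoly_eval (g i) v)"
  by (induction p rule: poly_mapping_induct)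
    (simp_all add: mpoly_subst_single mpoly_subst_add mpoly_eval_simps mpoly_eval_prod
      mpoly_eval_single)

lemma partial_deriv_single:
  "partial_deriv i (Poly_Mapping.single m c) =
    Poly_Mapping.single (m - Poly_Mapping.single i 1) (of_nat (Poly_Mapping.lookup m i) * c)"
  unfolding partial_deriv_def
  by (rule sum_keys_single[where h = "\<lambda>m c. Poly_Mapping.single (m - Poly_Mapping.single i 1)
        (of_nat (Poly_Mapping.lookup m i) * c)"]) simp

lemma partial_deriv_add: "partial_deriv i (p + q) = partial_deriv i p + partial_deriv i q"
  unfolding partial_deriv_def
  by (rule sum_keys_add[where h = "\<lambda>m c. Poly_Mapping.single (m - Poly_Mapping.single i 1)
        (of_nat (Poly_Mapping.lookup m i) * c)"])
    (simp_all add: single_add distrib_left)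

lemma partial_deriv_mult:
  "partial_deriv i (p * q) = partial_deriv i p * q + p * partial_deriv i q"
proof (induction p rule: poly_mapping_induct)
  case (single m c)
  show ?case
  proof (induction q rule: poly_mapping_induct)
    case (single n d)
    let ?e = "Poly_Mapping.single i (1::nat)"
    \<comment> \<open>Subtraction of exponents is truncated, so it commutes with adding
      \<open>n\<close> only if the variable occurs in \<open>m\<close>; otherwise both coefficients
      are 0.\<close>
    have 1: "Poly_Mapping.single (m - ?e + n) (of_nat (Poly_Mapping.lookup m i) * c * d) =
        Poly_Mapping.single (m + n - ?e) (of_nat (Poly_Mapping.lookup m i) * c * d)"
    proof (cases "Poly_Mapping.lookup m i = 0")
      case False
      then have "m - ?e + n = m + n - ?e"
        by (intro poly_mapping_eqI) (auto simp: lookup_add lookup_minus lookup_single when_def)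
      then show ?thesis by simp
    qed simp
    have 2: "Poly_Mapping.single (m + (n - ?e)) (c * (of_nat (Poly_Mapping.lookup n i) * d)) =
        Poly_Mapping.single (m + n - ?e) (c * (of_nat (Poly_Mapping.lookup n i) * d))"
    proof (cases "Poly_Mapping.lookup n i = 0")
      case False
      then have "m + (n - ?e) = m + n - ?e"
        by (intro poly_mapping_eqI) (auto simp: lookup_add lookup_minus lookup_single when_def)
      then show ?thesis by simp
    qed simp
    show ?case
      unfolding mult_single partial_deriv_single 1 2
      by (simp add: lookup_add single_add[symmetric] algebra_simps)
  qed (simp add: partial_deriv_add algebra_simps)
qed (simp add: partial_deriv_add algebra_simps)

lemma partial_deriv_Cst [simp]: "partial_deriv i (Cst c) = 0"
  by (simp add: Cst_def partial_deriv_single)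

lemma partial_deriv_Var: "partial_deriv i (Var j) = (if i = j then 1 else 0)"
  by (simp add: Var_def partial_deriv_single lookup_single when_def)

lemma partial_deriv_uminus: "partial_deriv i (- p) = - partial_deriv i p"
proof -
  have "partial_deriv i (p - p) = 0" by (simp add: partial_deriv_def)
  then show ?thesis using partial_deriv_add[of i p "- p"] by (simp add: eq_neg_iff_add_eq_0 add.commute)
qed

section \<open>Homogeneity and coefficients\<close>

lemma homogeneous_add: "homogeneous d p \<Longrightarrow> homogeneous d q \<Longrightarrow> homogeneous d (p + q)"
  for p q :: "('n::finite, 'k::comm_ring_1) mpoly"
  using keys_add[of p q] by (fastforce simp: homogeneous_def)

lemma homogeneous_uminus: "homogeneous d p \<Longrightarrow> homogeneous d (- p)"
  for p :: "('n::finite, 'k::comm_ring_1) mpoly"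
  by (simp add: homogeneous_def in_keys_iff)

lemma homogeneous_mult: "homogeneous d p \<Longrightarrow> homogeneous e q \<Longrightarrow> homogeneous (d + e) (p * q)"
  for p q :: "('n::finite, 'k::comm_ring_1) mpoly"
  using keys_mult[of p q] by (fastforce simp: homogeneous_def lookup_add sum.distrib)

lemma homogeneous_Cst: "homogeneous 0 (Cst c)"
  by (simp add: homogeneous_def Cst_def)

lemma homogeneous_Var: "homogeneous 1 (Var i)"
  by (simp add: homogeneous_def Var_def lookup_single when_def)

definition is_subring :: "'k::comm_ring_1 set \<Rightarrow> bool" where
  "is_subring K \<longleftrightarrow> 0 \<in> K \<and> 1 \<in> K \<and>
    (\<forall>x\<in>K. \<forall>y\<in>K. x + y \<in> K \<and> x * y \<in> K) \<and> (\<forall>x\<in>K. - x \<in> K)"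

lemma coeffs_in_add: "is_subring K \<Longrightarrow> coeffs_in K p \<Longrightarrow> coeffs_in K q \<Longrightarrow> coeffs_in K (p + q)"
  by (simp add: coeffs_in_def is_subring_def lookup_add)

lemma coeffs_in_uminus: "is_subring K \<Longrightarrow> coeffs_in K p \<Longrightarrow> coeffs_in K (- p)"
  by (simp add: coeffs_in_def is_subring_def)

lemma coeffs_in_single: "is_subring K \<Longrightarrow> c \<in> K \<Longrightarrow> coeffs_in K (Poly_Mapping.single m c)"
  by (simp add: coeffs_in_def is_subring_def lookup_single when_def)

lemma coeffs_in_Cst: "is_subring K \<Longrightarrow> c \<in> K \<Longrightarrow> coeffs_in K (Cst c)"
  by (simp add: Cst_def coeffs_in_single)

lemma coeffs_in_Var: "is_subring K \<Longrightarrow> coeffs_in K (Var i)"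
  unfolding Var_def by (rule coeffs_in_single) (simp_all add: is_subring_def)

lemma coeffs_in_mult:
  fixes p q :: "('n, 'k::comm_ring_1) mpoly"
  assumes K: "is_subring K" and p: "coeffs_in K p" and q: "coeffs_in K q"
  shows "coeffs_in K (p * q)"
proof -
  have 0: "coeffs_in K (0 :: ('n, 'k) mpoly)" using K by (simp add: coeffs_in_def is_subring_def)
  have sum: "coeffs_in K (\<Sum>m\<in>A. f m)" if "\<And>m. coeffs_in K (f m)"
    for A and f :: "_ \<Rightarrow> ('n, 'k) mpoly"
    by (induction A rule: infinite_finite_induct) (simp_all add: 0 that coeffs_in_add[OF K])
  have decomp: "(\<Sum>m\<in>Poly_Mapping.keys r. Poly_Mapping.single m (Poly_Mapping.lookup r m)) = r"
    for r :: "('n, 'k) mpoly"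
    by (rule poly_mapping_eqI)
      (auto simp: lookup_sum lookup_single when_def sum.delta in_keys_iff)
  have "p * q = (\<Sum>m\<in>Poly_Mapping.keys p. \<Sum>n\<in>Poly_Mapping.keys q.
      Poly_Mapping.single (m + n) (Poly_Mapping.lookup p m * Poly_Mapping.lookup q n))"
    by (subst (1) decomp[of p, symmetric], subst (1) decomp[of q, symmetric])
      (simp only: sum_product mult_single)
  also have "coeffs_in K \<dots>"
    by (intro sum coeffs_in_single K) (use K p q in \<open>simp add: coeffs_in_def is_subring_def\<close>)
  finally show ?thesis .
qed

section \<open>Elementary symmetric polynomials in five variables\<close>

text \<open>Restricting to subsets of \<open>S\<close> allows a recursion on \<open>S\<close>, which
  computes the explicit expansions in five variables.\<close>

definition esym_on :: "nat \<Rightarrow> ('i \<Rightarrow> 'a::comm_ring_1) \<Rightarrow> 'i set \<Rightarrow> 'a" where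
  "esym_on d f S = (\<Sum>A | A \<subseteq> S \<and> card A = d. \<Prod>i\<in>A. f i)"

lemma esym_on_0: "finite S \<Longrightarrow> esym_on 0 f S = 1"
proof -
  assume "finite S"
  then have "{A. A \<subseteq> S \<and> card A = 0} = {{}}"
    by (auto dest: finite_subset)
  then show ?thesis by (simp add: esym_on_def)
qed

lemma esym_on_empty: "esym_on (Suc d) (f :: 'a \<Rightarrow> 'b::comm_ring_1) {} = 0"
proof -
  have no_subset: "{A. A \<subseteq> ({} :: 'a set) \<and> card A = Suc d} = {}" by auto
  show ?thesis unfolding esym_on_def no_subset by simp
qed

text \<open>Pascal's recursion: a subset of size d + 1 either avoids \<open>x\<close> or is
  \<open>x\<close> together with a subset of size d.\<close>

lemma esym_on_insert:
  assumes "finite S" "x \<notin> S"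
  shows "esym_on (Suc d) f (insert x S) = esym_on (Suc d) f S + f x * esym_on d f S"
proof -
  have fin: "finite A" if "A \<subseteq> S" for A using that assms(1) finite_subset by blast
  have split: "{A. A \<subseteq> insert x S \<and> card A = Suc d} =
      {A. A \<subseteq> S \<and> card A = Suc d} \<union> insert x ` {A. A \<subseteq> S \<and> card A = d}" (is "?L = ?R1 \<union> ?R2")
  proof (intro equalityI subsetI)
    fix A assume A: "A \<in> ?L"
    show "A \<in> ?R1 \<union> ?R2"
    proof (cases "x \<in> A")
      case True
      then have "A = insert x (A - {x})" "A - {x} \<subseteq> S" "card (A - {x}) = d"
        using A by auto
      then show ?thesis by blast
    qed (use A in auto)
  qed (use assms fin in \<open>auto simp: card_insert_if\<close>)
  have inj: "inj_on (insert x) {A. A \<subseteq> S \<and> card A = d}"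
    using assms(2) by (intro inj_onI) (metis insert_ident mem_Collect_eq subsetD)
  have "sum (\<lambda>A. \<Prod>i\<in>A. f i) ?L = sum (\<lambda>A. \<Prod>i\<in>A. f i) ?R1 + sum (\<lambda>A. \<Prod>i\<in>A. f i) ?R2"
    unfolding split using assms by (intro sum.union_disjoint) auto
  also have "sum (\<lambda>A. \<Prod>i\<in>A. f i) ?R2 = f x * esym_on d f S"
    unfolding esym_on_def sum_distrib_left sum.reindex[OF inj] o_def
    using assms(2) fin by (intro sum.cong refl) (subst prod.insert, auto)
  finally show ?thesis by (simp add: esym_on_def)
qed

lemma exhaust_5: "x = 1 \<or> x = 2 \<or> x = 3 \<or> x = 4 \<or> x = 5" for x :: 5
proof (induct x)
  case (of_int z)
  then have "0 \<le> z" and "z < 5" by simp_all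
  then have "z = 0 \<or> z = 1 \<or> z = 2 \<or> z = 3 \<or> z = 4" by arith
  then show ?case by auto
qed

lemma UNIV_5: "UNIV = {1, 2, 3, 4, 5::5}"
  using exhaust_5 by auto

lemma forall_5: "(\<forall>i::5. P i) \<longleftrightarrow> P 1 \<and> P 2 \<and> P 3 \<and> P 4 \<and> P 5"
  by (metis exhaust_5)

lemma elem_sym_on: "elem_sym d = esym_on d Var {1, 2, 3, 4, 5::5}"
  by (simp add: elem_sym_def esym_on_def flip: UNIV_5)

text \<open>The recursion is on \<open>Suc\<close>, while the degrees 2 and 4 are numerals; the
  \<open>pred_numeral\<close> instances make it fire on them.\<close>

lemmas esym_on_simps = esym_on_0 esym_on_empty esym_on_insert
  esym_on_empty[of "pred_numeral k" for k, folded numeral_eq_Suc]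
  esym_on_insert[of _ _ "pred_numeral k" for k, folded numeral_eq_Suc]

lemma elem_sym_1: "elem_sym 1 = Var 1 + Var 2 + Var 3 + Var 4 + Var (5::5)"
  unfolding elem_sym_on One_nat_def by (simp add: esym_on_simps algebra_simps)

lemma elem_sym_2: "elem_sym 2 =
    Var 1 * Var 2 + Var 1 * Var 3 + Var 1 * Var 4 + Var 1 * Var 5 + Var 2 * Var 3 +
    Var 2 * Var 4 + Var 2 * Var 5 + Var 3 * Var 4 + Var 3 * Var 5 + Var 4 * Var (5::5)"
  unfolding elem_sym_on by (simp add: esym_on_simps algebra_simps)

lemma elem_sym_4: "elem_sym 4 =
    Var 1 * Var 2 * Var 3 * Var 4 + Var 1 * Var 2 * Var 3 * Var 5 +
    Var 1 * Var 2 * Var 4 * Var 5 + Var 1 * Var 3 * Var 4 * Var 5 + Var 2 * Var 3 * Var 4 * Var (5::5)"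
  unfolding elem_sym_on by (simp add: esym_on_simps algebra_simps)

section \<open>Arithmetic in characteristic two\<close>

lemma F2bar_two: "(2 :: F2bar) = 0"
  using to_ac_numeral[of "num.Bit0 num.One", where 'a = bit] by simp

lemma F2bar_add_self [simp]: "x + x = 0" for x :: F2bar
  using F2bar_two by (metis mult_2 mult_zero_left)

text \<open>Reordering brings equal summands together; inside a right-nested sum they cancel by this
  form. With it, rewriting by \<open>F2bar_ring_simps\<close> proves polynomial identities in
  characteristic two.\<close>

lemma F2bar_add_self_left [simp]: "x + (x + y) = y" for x y :: F2bar
  by (simp flip: add.assoc)

lemma F2bar_uminus [simp]: "- x = x" for x :: F2bar
  by (rule minus_unique) simp

lemma F2bar_diff [simp]: "x - y = x + y" for x y :: F2bar
  by (simp only: diff_conv_add_uminus F2bar_uminus)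

lemma F2bar_add_eq_0_iff: "x + y = 0 \<longleftrightarrow> x = y" for x y :: F2bar
  using eq_iff_diff_eq_0[of x y] by simp

lemmas F2bar_ring_simps =
  distrib_left distrib_right add.assoc add.commute add.left_commute
  mult.assoc mult.commute mult.left_commute power2_eq_square power3_eq_cube power4_eq_xxxx

text \<open>This gives the closure of \<open>Fq (2 ^ n)\<close> under addition.\<close>

lemma F2bar_frobenius: "(x + y) ^ (2 ^ n) = x ^ (2 ^ n) + y ^ (2 ^ n)" for x y :: F2bar
proof (induction n)
  case (Suc n)
  have "(a + b)\<^sup>2 = a\<^sup>2 + b\<^sup>2" for a b :: F2bar
    by (simp add: F2bar_ring_simps)
  with Suc show ?case by (simp only: power_Suc2 power_mult)
qed simp

lemma is_subring_Fq: "is_subring (Fq (2 ^ n))"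
  by (auto simp: is_subring_def Fq_def F2bar_frobenius power_mult_distrib)

section \<open>Smoothness\<close>

definition e2 :: "F2bar ^ 5 \<Rightarrow> F2bar" where
  "e2 v = v$1 * v$2 + v$1 * v$3 + v$1 * v$4 + v$1 * v$5 + v$2 * v$3 +
    v$2 * v$4 + v$2 * v$5 + v$3 * v$4 + v$3 * v$5 + v$4 * v$5"

definition e4 :: "F2bar ^ 5 \<Rightarrow> F2bar" where
  "e4 v = v$1 * v$2 * v$3 * v$4 + v$1 * v$2 * v$3 * v$5 +
    v$1 * v$2 * v$4 * v$5 + v$1 * v$3 * v$4 * v$5 + v$2 * v$3 * v$4 * v$5"

definition e3 :: "F2bar \<Rightarrow> F2bar \<Rightarrow> F2bar \<Rightarrow> F2bar \<Rightarrow> F2bar" where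
  "e3 a b c d = a * b * c + a * b * d + a * c * d + b * c * d"

definition e4_grad :: "F2bar ^ 5 \<Rightarrow> F2bar ^ 5" where
  "e4_grad v = (\<chi> i. if i = 1 then e3 (v$2) (v$3) (v$4) (v$5)
    else if i = 2 then e3 (v$1) (v$3) (v$4) (v$5) else if i = 3 then e3 (v$1) (v$2) (v$4) (v$5)
    else if i = 4 then e3 (v$1) (v$2) (v$3) (v$5) else e3 (v$1) (v$2) (v$3) (v$4))"

lemma e3_commute: "e3 a b c d = e3 b a c d" "e3 a b c d = e3 a c b d" "e3 a b c d = e3 a b d c"
  by (simp_all add: e3_def F2bar_ring_simps)

text \<open>For coordinates a, a, p, q, r all terms containing 2a disappear, so \<open>eq\<close> is
  the quartic equation and \<open>e3 a a x y\<close> is a^2 (x + y). If a = 0, then pqr = 0; the two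
  remaining coordinates agree and \<mu> times the fourth power of one of them is 0. If a is nonzero,
  then p = q = r with sum 0, so all three vanish and \<mu> a^4 = 0, a contradiction.\<close>

lemma singular_equal_pair:
  fixes a p q r \<mu> :: F2bar
  assumes \<mu>: "\<mu> \<noteq> 0" and s1: "p + q + r = 0"
    and grad: "e3 a p q r = e3 a a q r" "e3 a a p r = e3 a a q r" "e3 a a p q = e3 a a q r"
    and eq: "a\<^sup>2 * (p * q + p * r + q * r) + \<mu> * (a\<^sup>2 + p * q + p * r + q * r)\<^sup>2 = 0"
  shows "a = 0 \<and> p = 0 \<and> q = 0 \<and> r = 0"
proof -
  have r: "r = p + q" using s1 by (simp add: F2bar_add_eq_0_iff)
  have e: "e3 a a x y = a\<^sup>2 * (x + y)" for x y
    by (simp add: e3_def F2bar_ring_simps)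
  show ?thesis
  proof (cases "a = 0")
    case True
    then have "p * q * r = 0" using grad(1) by (simp add: e3_def)
    then show ?thesis using eq \<mu> True r by (auto simp: F2bar_add_eq_0_iff)
  next
    case False
    then have "p + r = q + r" "q + p = q + r" using grad(2,3) unfolding e
      by (simp_all add: add.commute)
    then have "p = q" "p = r" by (metis add_right_cancel add.commute)+
    moreover from this have "r = 0" using r by (metis F2bar_add_self)
    ultimately show ?thesis using eq \<mu> False by simp
  qed
qed

text \<open>Two coordinates always agree: if \<open>x\<^sub>1, x\<^sub>2, x\<^sub>3\<close> are distinct, adding the conditions
  \<open>e\<^sub>2(x\<^sub>3, x\<^sub>4, x\<^sub>5) = 0\<close> and \<open>e\<^sub>2(x\<^sub>2, x\<^sub>4, x\<^sub>5) = 0\<close> gives \<open>(x\<^sub>2 + x\<^sub>3)(x\<^sub>4 + x\<^sub>5) = 0\<close>.\<close>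

lemma singular_point_eq_0:
  fixes v :: "F2bar ^ 5"
  assumes \<mu>: "\<mu> \<noteq> 0" and s1: "v$1 + v$2 + v$3 + v$4 + v$5 = 0"
    and grad: "\<And>i j. e4_grad v $ i = e4_grad v $ j"
    and eq: "e4 v + \<mu> * (e2 v)\<^sup>2 = 0"
  shows "v = 0"
proof -
  obtain a b c d e where v: "v$1 = a" "v$2 = b" "v$3 = c" "v$4 = d" "v$5 = e" by blast
  have s: "a + b + c + d + e = 0" using s1 v by simp
  have g: "e3 b c d e = e3 a b c d" "e3 a c d e = e3 a b c d" "e3 a b d e = e3 a b c d"
      "e3 a b c e = e3 a b c d"
    using grad[of 1 5] grad[of 2 5] grad[of 3 5] grad[of 4 5] v by (simp_all add: e4_grad_def)
  have q: "a*b*c*d + a*b*c*e + a*b*d*e + a*c*d*e + b*c*d*e +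
      \<mu> * (a*b + a*c + a*d + a*e + b*c + b*d + b*e + c*d + c*e + d*e)\<^sup>2 = 0"
    using eq by (simp add: e4_def e2_def v)
  have "a = 0 \<and> b = 0 \<and> c = 0 \<and> d = 0 \<and> e = 0"
  proof -
    consider "a = b" | "a = c" | "b = c" | "a \<noteq> b" "a \<noteq> c" "b \<noteq> c" by blast
    then show ?thesis
    proof cases
      case 1
      have s4: "a*b*c*d + a*b*c*e + a*b*d*e + a*c*d*e + b*c*d*e = a\<^sup>2 * (c * d + c * e + d * e)"
        and s2: "a*b + a*c + a*d + a*e + b*c + b*d + b*e + c*d + c*e + d*e = a\<^sup>2 + c * d + c * e + d * e"
        by (simp_all add: 1 F2bar_ring_simps)
      have "a = 0 \<and> c = 0 \<and> d = 0 \<and> e = 0"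
      proof (rule singular_equal_pair[OF \<mu>])
        show "c + d + e = 0" using s 1 by (simp add: add_ac)
        show "e3 a c d e = e3 a a d e" "e3 a a c e = e3 a a d e"
          "e3 a a c d = e3 a a d e"
          using g 1 by (simp_all add: e3_commute)
      qed (use q in \<open>simp only: s4 s2\<close>)
      then show ?thesis using 1 by simp
    next
      case 2
      have s4: "a*b*c*d + a*b*c*e + a*b*d*e + a*c*d*e + b*c*d*e = a\<^sup>2 * (b * d + b * e + d * e)"
        and s2: "a*b + a*c + a*d + a*e + b*c + b*d + b*e + c*d + c*e + d*e = a\<^sup>2 + b * d + b * e + d * e"
        by (simp_all add: 2 F2bar_ring_simps)
      have "a = 0 \<and> b = 0 \<and> d = 0 \<and> e = 0"
      proof (rule singular_equal_pair[OF \<mu>])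
        show "b + d + e = 0" using s 2 by (simp add: add_ac)
        show "e3 a b d e = e3 a a d e" "e3 a a b e = e3 a a d e"
          "e3 a a b d = e3 a a d e"
          using g 2 by (simp_all add: e3_commute)
      qed (use q in \<open>simp only: s4 s2\<close>)
      then show ?thesis using 2 by simp
    next
      case 3
      have s4: "a*b*c*d + a*b*c*e + a*b*d*e + a*c*d*e + b*c*d*e = b\<^sup>2 * (a * d + a * e + d * e)"
        and s2: "a*b + a*c + a*d + a*e + b*c + b*d + b*e + c*d + c*e + d*e = b\<^sup>2 + a * d + a * e + d * e"
        by (simp_all add: 3 F2bar_ring_simps)
      have "b = 0 \<and> a = 0 \<and> d = 0 \<and> e = 0"
      proof (rule singular_equal_pair[OF \<mu>])
        show "a + d + e = 0" using s 3 by (simp add: add_ac)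
        show "e3 b a d e = e3 b b d e" "e3 b b a e = e3 b b d e"
          "e3 b b a d = e3 b b d e"
          using g 3 by (simp_all add: e3_commute)
      qed (use q in \<open>simp only: s4 s2\<close>)
      then show ?thesis using 3 by simp
    next
      case 4
      have "(a + b) * (c * d + c * e + d * e) = e3 b c d e + e3 a c d e"
        "(a + c) * (b * d + b * e + d * e) = e3 b c d e + e3 a b d e"
        by (simp_all add: e3_def F2bar_ring_simps)
      then have "c * d + c * e + d * e = 0" "b * d + b * e + d * e = 0"
        using 4 g by (auto simp: F2bar_add_eq_0_iff)
      moreover have "(b + c) * (d + e) = (c * d + c * e + d * e) + (b * d + b * e + d * e)"
        by (simp add: F2bar_ring_simps)
      ultimately have "(b + c) * (d + e) = 0" by simp
      then have de: "d = e" using 4 by (simp add: F2bar_add_eq_0_iff)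
      have s4: "a*b*c*d + a*b*c*e + a*b*d*e + a*c*d*e + b*c*d*e = d\<^sup>2 * (a * b + a * c + b * c)"
        and s2: "a*b + a*c + a*d + a*e + b*c + b*d + b*e + c*d + c*e + d*e = d\<^sup>2 + a * b + a * c + b * c"
        by (simp_all add: de F2bar_ring_simps)
      have "d = 0 \<and> a = 0 \<and> b = 0 \<and> c = 0"
      proof (rule singular_equal_pair[OF \<mu>])
        show "a + b + c = 0" using s de by (simp add: add_ac)
        show "e3 d a b c = e3 d d b c" "e3 d d a c = e3 d d b c"
          "e3 d d a b = e3 d d b c"
          using g unfolding de by (metis e3_commute)+
      qed (use q in \<open>simp only: s4 s2\<close>)
      then show ?thesis using de by simp
    qed
  qed
  then show ?thesis using v by (simp add: vec_eq_iff forall_5)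
qed

section \<open>Values and gradients of the equations in five coordinates\<close>

lemma mpoly_eval_S_quartic: "mpoly_eval (S_quartic \<mu>) v = e4 v + \<mu> * (e2 v)\<^sup>2"
  by (simp only: S_quartic_def elem_sym_4 elem_sym_2 mpoly_eval_simps mpoly_eval_Var
      mpoly_eval_Cst e4_def e2_def)

lemma mpoly_eval_elem_sym_1: "mpoly_eval (elem_sym 1) v = v$1 + v$2 + v$3 + v$4 + v$(5::5)"
  by (simp only: elem_sym_1 mpoly_eval_simps mpoly_eval_Var)

text \<open>Stated after evaluation because the cancellation rules of characteristic two are
  available for elements of \<open>F2bar\<close>, not for polynomials over it.\<close>

lemma mpoly_eval_partial_deriv:
  fixes p q :: "('n::finite, F2bar) mpoly"
  shows "mpoly_eval (partial_deriv i (p + q)) v =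
      mpoly_eval (partial_deriv i p) v + mpoly_eval (partial_deriv i q) v"
    and "mpoly_eval (partial_deriv i (p * q)) v =
      mpoly_eval (partial_deriv i p) v * mpoly_eval q v + mpoly_eval p v * mpoly_eval (partial_deriv i q) v"
    and "mpoly_eval (partial_deriv i (p\<^sup>2)) v = 0"
    and "mpoly_eval (partial_deriv i (- p)) v = mpoly_eval (partial_deriv i p) v"
    and "mpoly_eval (partial_deriv i (Cst c)) v = 0"
    and "mpoly_eval (partial_deriv i (Var j)) v = (if i = j then 1 else 0)"
  by (simp_all only: power2_eq_square partial_deriv_add partial_deriv_mult partial_deriv_uminus
      partial_deriv_Var partial_deriv_Cst mpoly_eval_simps)
    (simp_all add: mult.commute)

lemma gradient_elem_sym_1: "gradient (elem_sym 1) v = (\<chi> i. 1)" for v :: "F2bar ^ 5"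
  by (simp only: gradient_def elem_sym_1 mpoly_eval_partial_deriv vec_eq_iff vec_lambda_beta forall_5)
    simp

lemma gradient_S_quartic: "gradient (S_quartic \<mu>) v = e4_grad v"
  by (simp only: vec_eq_iff forall_5 gradient_def vec_lambda_beta S_quartic_def elem_sym_4
      elem_sym_2 mpoly_eval_partial_deriv mpoly_eval_simps mpoly_eval_Var)
    (simp add: e4_grad_def e3_def F2bar_ring_simps)

section \<open>The quartic in the coordinates of P^3\<close>

lemma hyperplane_coords_simps [simp]:
  "hyperplane_coords 1 = Var 1" "hyperplane_coords 2 = Var 2" "hyperplane_coords 3 = Var 3"
  "hyperplane_coords 4 = Var 4" "hyperplane_coords 5 = - (Var 1 + Var 2 + Var 3 + Var 4)"
  by (simp_all add: hyperplane_coords_def)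

definition lift_hyperplane :: "F2bar ^ 4 \<Rightarrow> F2bar ^ 5" where
  "lift_hyperplane w = (\<chi> i. mpoly_eval (hyperplane_coords i) w)"

lemma lift_hyperplane_nth [simp]:
  "lift_hyperplane w $ 1 = w $ 1" "lift_hyperplane w $ 2 = w $ 2"
  "lift_hyperplane w $ 3 = w $ 3" "lift_hyperplane w $ 4 = w $ 4"
  "lift_hyperplane w $ 5 = w $ 1 + w $ 2 + w $ 3 + w $ 4"
  by (simp_all add: lift_hyperplane_def mpoly_eval_simps del: minus_add_distrib)

lemma mpoly_eval_S_quartic_P3:
  "mpoly_eval (S_quartic_P3 \<mu>) w = mpoly_eval (S_quartic \<mu>) (lift_hyperplane w)"
  by (simp add: S_quartic_P3_def mpoly_eval_subst lift_hyperplane_def)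

text \<open>Keeping \<open>u\<close> as one linear form avoids expanding the quartic: degree,
  coefficient field and derivatives are then read off from sums and products of five linear
  forms.\<close>

lemma S_quartic_P3_eq: "S_quartic_P3 \<mu> =
  (let x = Var 1; y = Var 2; z = Var 3; t = Var 4; u = - (Var 1 + Var 2 + Var 3 + Var 4)
   in x * y * z * t + x * y * z * u + x * y * t * u + x * z * t * u + y * z * t * u +
      Cst \<mu> * (x*y + x*z + x*t + x*u + y*z + y*t + y*u + z*t + z*u + t*u)\<^sup>2)"
  by (simp add: S_quartic_P3_def S_quartic_def elem_sym_4 elem_sym_2 Let_def
    mpoly_subst_add mpoly_subst_mult mpoly_subst_power)

text \<open>The chain rule for x_5 = -(x_1 + x_2 + x_3 + x_4), with signs erased by characteristic
  two; the square contributes nothing.\<close>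

lemma gradient_S_quartic_P3:
  "gradient (S_quartic_P3 \<mu>) w $ 1 = e4_grad (lift_hyperplane w) $ 1 + e4_grad (lift_hyperplane w) $ 5"
  "gradient (S_quartic_P3 \<mu>) w $ 2 = e4_grad (lift_hyperplane w) $ 2 + e4_grad (lift_hyperplane w) $ 5"
  "gradient (S_quartic_P3 \<mu>) w $ 3 = e4_grad (lift_hyperplane w) $ 3 + e4_grad (lift_hyperplane w) $ 5"
  "gradient (S_quartic_P3 \<mu>) w $ 4 = e4_grad (lift_hyperplane w) $ 4 + e4_grad (lift_hyperplane w) $ 5"
  by (simp_all only: gradient_def vec_lambda_beta S_quartic_P3_eq Let_def
      mpoly_eval_partial_deriv mpoly_eval_simps mpoly_eval_Var)
    (simp_all add: e4_grad_def e3_def F2bar_ring_simps)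

section \<open>The Jacobian criterion in P^4 and in P^3\<close>

lemma smooth_S_eqs:
  assumes "\<mu> \<noteq> 0"
  shows "smooth_of_dim 2 (S_eqs \<mu>)"
  unfolding smooth_of_dim_def
proof (intro ballI impI)
  fix P v assume P: "P \<in> zero_locus (S_eqs \<mu>)" and v: "v \<in> P" "v \<noteq> 0"
  have s1: "v$1 + v$2 + v$3 + v$4 + v$5 = 0" and eq: "e4 v + \<mu> * (e2 v)\<^sup>2 = 0"
    using P v(1) mpoly_eval_elem_sym_1[of v] mpoly_eval_S_quartic[of \<mu> v]
    by (auto simp: zero_locus_def S_eqs_def)
  let ?u = "(\<chi> i. 1) :: F2bar ^ 5"
  have u: "?u \<noteq> 0" by (simp add: vec_eq_iff)
  \<comment> \<open>The all-ones vector is the gradient of s_1. Rank 2 means that the gradient of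
    s_4 is not a multiple of it, that is, not constant.\<close>
  have "e4_grad v \<notin> vec.span {?u}"
  proof
    assume "e4_grad v \<in> vec.span {?u}"
    then obtain k where "e4_grad v = k *s ?u" by (auto simp: vec.span_singleton)
    then have "e4_grad v $ i = e4_grad v $ j" for i j by simp
    from singular_point_eq_0[OF assms s1 this eq] show False using v by simp
  qed
  then have "vec.independent {e4_grad v, ?u}" "e4_grad v \<noteq> ?u"
    using u vec.span_base[of ?u "{?u}"] by (auto simp: vec.independent_insert)
  moreover have "(\<lambda>p. gradient p v) ` S_eqs \<mu> = {e4_grad v, ?u}"
    unfolding S_eqs_def using gradient_elem_sym_1[of v] gradient_S_quartic[of \<mu> v] by auto
  ultimately show "vec.dim ((\<lambda>p. gradient p v) ` S_eqs \<mu>) + 2 + 1 = CARD(5)"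
    by (simp add: vec.dim_eq_card_independent)
qed

lemma homogeneous_hyperplane_coords: "homogeneous 1 (hyperplane_coords i)"
  unfolding hyperplane_coords_def
  by (simp only: split: if_split) (intro conjI impI homogeneous_Var homogeneous_uminus homogeneous_add)

lemma homogeneous_S_quartic_P3: "homogeneous 4 (S_quartic_P3 \<mu>)"
proof -
  have m2: "homogeneous 2 (p * q)" if "homogeneous 1 p" "homogeneous 1 q" for p q :: "(4, F2bar) mpoly"
    using homogeneous_mult[OF that] by (simp add: numeral_2_eq_2)
  have m4: "homogeneous 4 (p * q)" if "homogeneous 2 p" "homogeneous 2 q" for p q :: "(4, F2bar) mpoly"
    using homogeneous_mult[OF that] by simp
  have C: "homogeneous 4 (Cst c * p)" if "homogeneous 4 p" for p :: "(4, F2bar) mpoly" and c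
    using homogeneous_mult[OF homogeneous_Cst that] by simp
  show ?thesis
    unfolding S_quartic_P3_eq Let_def power2_eq_square mult.assoc
    \<comment> \<open>Products of four linear forms are regrouped as a quadratic form times a
      quadratic form, the shape that \<open>m4\<close> and \<open>m2\<close> expect.\<close>
    unfolding mult.assoc[symmetric, of "Var _" "Var _" "_ * _"]
    by (intro homogeneous_add m4 C m2 homogeneous_Var homogeneous_uminus)
qed

lemma smooth_quartic_surface_S_quartic_P3:
  assumes "\<mu> \<noteq> 0"
  shows "smooth_quartic_surface (S_quartic_P3 \<mu>)"
  unfolding smooth_quartic_surface_def
proof (intro conjI)
  \<comment> \<open>This point lifts to (1, 1, 1, 0, 1), where s_4 = 1 and s_2 = 6 = 0, so the
    quartic takes the value 1 whatever \<mu> is.\<close>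
  let ?w = "(\<chi> i. if i = 4 then 0 else 1) :: F2bar ^ 4"
  have "mpoly_eval (S_quartic_P3 \<mu>) ?w = 1"
    by (simp add: mpoly_eval_S_quartic_P3 mpoly_eval_S_quartic e4_def e2_def)
  then show "S_quartic_P3 \<mu> \<noteq> 0" by auto
  show "homogeneous 4 (S_quartic_P3 \<mu>)" by (rule homogeneous_S_quartic_P3)
  show "smooth_of_dim 2 {S_quartic_P3 \<mu>}"
    unfolding smooth_of_dim_def
  proof (intro ballI impI)
    fix P w assume P: "P \<in> zero_locus {S_quartic_P3 \<mu>}" and w: "w \<in> P" "w \<noteq> 0"
    let ?v = "lift_hyperplane w" and ?g = "gradient (S_quartic_P3 \<mu>) w"
    have s1: "?v$1 + ?v$2 + ?v$3 + ?v$4 + ?v$5 = 0" by (simp add: add_ac)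
    have eq: "e4 ?v + \<mu> * (e2 ?v)\<^sup>2 = 0"
      using P w(1) mpoly_eval_S_quartic_P3[of \<mu> w]
      by (auto simp: zero_locus_def mpoly_eval_S_quartic)
    have "?v \<noteq> 0" using w(2) by (auto simp: vec_eq_iff forall_4 forall_5)
    have "?g \<noteq> 0"
    proof
      assume "?g = 0"
      then have "e4_grad ?v $ i = e4_grad ?v $ 5" for i
        using exhaust_5[of i] gradient_S_quartic_P3[of \<mu> w]
        by (auto simp: F2bar_add_eq_0_iff)
      then have "e4_grad ?v $ i = e4_grad ?v $ j" for i j by metis
      from singular_point_eq_0[OF assms s1 this eq] show False using \<open>?v \<noteq> 0\<close> by simp
    qed
    then have "vec.dim {?g} = 1"
      by (subst vec.dim_eq_card_independent) (auto simp: vec.independent_insert)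
    then show "vec.dim ((\<lambda>p. gradient p w) ` {S_quartic_P3 \<mu>}) + 2 + 1 = CARD(4)"
      by simp
  qed
qed

section \<open>Fields of definition of the equations\<close>

lemma coeffs_in_hyperplane_coords: "is_subring K \<Longrightarrow> coeffs_in K (hyperplane_coords i)"
  unfolding hyperplane_coords_def
  by (simp only: split: if_split) (intro conjI impI coeffs_in_Var coeffs_in_uminus coeffs_in_add)

lemma coeffs_in_S_quartic_P3:
  "is_subring K \<Longrightarrow> \<mu> \<in> K \<Longrightarrow> coeffs_in K (S_quartic_P3 \<mu>)"
  unfolding S_quartic_P3_eq Let_def power2_eq_square
  by (intro coeffs_in_add coeffs_in_mult coeffs_in_uminus coeffs_in_Var coeffs_in_Cst)

lemma coeffs_in_S_eqs:
  "is_subring K \<Longrightarrow> \<mu> \<in> K \<Longrightarrow> p \<in> S_eqs \<mu> \<Longrightarrow> coeffs_in K p"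
  unfolding S_eqs_def S_quartic_def elem_sym_1 elem_sym_2 elem_sym_4 power2_eq_square
  by (elim insertE emptyE; hypsubst)
    (intro coeffs_in_add coeffs_in_mult coeffs_in_Var coeffs_in_Cst; assumption)+

section \<open>Lines as sets of points\<close>

definition points_in :: "('k::field ^ 'n::finite) set \<Rightarrow> ('k ^ 'n) set set" where
  "points_in W = {P \<in> proj_space. P \<subseteq> W}"

lemma span_singleton_in_proj_space: "v \<noteq> 0 \<Longrightarrow> vec.span {v} \<in> proj_space"
  by (simp add: proj_space_def)

lemma proj_spaceE:
  assumes "P \<in> proj_space"
  obtains v where "v \<noteq> 0" "P = vec.span {v}"
proof -
  obtain B where B: "B \<subseteq> P" "vec.independent B" "P \<subseteq> vec.span B" "card B = vec.dim P"
    using vec.basis_exists by blast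
  have P: "vec.subspace P" "vec.dim P = 1" using assms by (auto simp: proj_space_def)
  with B(4) obtain v where v: "B = {v}" by (auto simp: card_1_singleton_iff)
  have "v \<noteq> 0" using B(2) v vec.dependent_zero by blast
  moreover have "P = vec.span {v}"
    using B(1,3) v P(1) vec.span_minimal by blast
  ultimately show ?thesis by (rule that)
qed

lemma subspace_imp_is_line: "vec.subspace W \<Longrightarrow> vec.dim W = 2 \<Longrightarrow> is_line (points_in W)"
  by (auto simp: is_line_def points_in_def)

text \<open>A subspace is recovered from its projective points, so comparing lines amounts to
  comparing subspaces. The set \<open>{0}\<close> is inserted because the zero subspace has no
  points.\<close>

lemma Union_points_in:
  assumes "vec.subspace W"
  shows "\<Union> (insert {0} (points_in W)) = W"
proof (intro equalityI subsetI)
  fix v assume v: "v \<in> W"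
  show "v \<in> \<Union> (insert {0} (points_in W))"
  proof (cases "v = 0")
    case False
    have "vec.span {v} \<subseteq> W" using v assms by (simp add: vec.span_minimal)
    then show ?thesis
      using span_singleton_in_proj_space[OF False] vec.span_base[of v "{v}"]
      by (auto simp: points_in_def)
  qed simp
qed (use assms in \<open>auto simp: points_in_def vec.subspace_0\<close>)

lemma points_in_inject:
  "vec.subspace V \<Longrightarrow> vec.subspace W \<Longrightarrow> points_in V = points_in W \<longleftrightarrow> V = W"
  by (metis Union_points_in)

lemma zero_locus_eq_points_in: "zero_locus F = points_in {v. \<forall>p\<in>F. mpoly_eval p v = 0}"
  by (auto simp: zero_locus_def points_in_def)

text \<open>Injectivity on \<open>W\<close> keeps spanning vectors nonzero, so points go to points.
  It serves both the permutations of coordinates and the projection to P^3.\<close>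

lemma image_points_in:
  fixes T :: "('k::field ^ 'n::finite) \<Rightarrow> ('k ^ 'm::finite)"
  assumes T: "Vector_Spaces.linear (*s) (*s) T" and inj: "inj_on T W" and W: "vec.subspace W"
  shows "image T ` points_in W = points_in (T ` W)"
proof (intro equalityI subsetI)
  have nz: "T v \<noteq> 0" if "v \<in> W" "v \<noteq> 0" for v
    using inj_onD[OF inj _ that(1) vec.subspace_0[OF W]] that vec.linear_0[OF T] by auto
  {
    fix Q assume "Q \<in> image T ` points_in W"
    then obtain P where P: "P \<in> proj_space" "P \<subseteq> W" "Q = T ` P" by (auto simp: points_in_def)
    from P(1) obtain v where v: "v \<noteq> 0" "P = vec.span {v}" by (rule proj_spaceE)
    then have "T v \<noteq> 0" using P(2) vec.span_base[of v "{v}"] by (intro nz) auto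
    moreover have "Q = vec.span {T v}"
      using vec.linear_span_image[OF T, of "{v}"] P v by simp
    ultimately show "Q \<in> points_in (T ` W)"
      using P by (auto simp: points_in_def span_singleton_in_proj_space)
  next
    fix Q assume "Q \<in> points_in (T ` W)"
    then have Q: "Q \<in> proj_space" "Q \<subseteq> T ` W" by (auto simp: points_in_def)
    from Q(1) obtain u where u: "u \<noteq> 0" "Q = vec.span {u}" by (rule proj_spaceE)
    then have "u \<in> T ` W" using Q(2) vec.span_base[of u "{u}"] by auto
    then obtain v where v: "v \<in> W" "u = T v" by auto
    have "v \<noteq> 0" using u(1) v(2) vec.linear_0[OF T] by auto
    moreover have "vec.span {v} \<subseteq> W" using v W by (simp add: vec.span_minimal)
    moreover have "Q = T ` vec.span {v}"
      using vec.linear_span_image[OF T, of "{v}"] u v by simp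
    ultimately show "Q \<in> image T ` points_in W"
      by (auto simp: points_in_def span_singleton_in_proj_space)
  }
qed

lemma linear_image_is_line:
  fixes T :: "('k::field ^ 'n::finite) \<Rightarrow> ('k ^ 'm::finite)"
  assumes T: "Vector_Spaces.linear (*s) (*s) T" and inj: "inj_on T W"
    and W: "vec.subspace W" "vec.dim W = 2"
  shows "is_line (points_in (T ` W))"
proof (rule subspace_imp_is_line)
  show "vec.subspace (T ` W)" by (rule vec.linear_subspace_image[OF T W(1)])
  have "vec.span W = W" using W(1) by (simp add: vec.span_eq_iff)
  then show "vec.dim (T ` W) = 2" using vec.dim_image_eq[OF T, of W] inj W(2) by metis
qed

section \<open>Permutation of coordinates\<close>

lemma permute_coords_compose:
  "bij \<sigma> \<Longrightarrow> bij \<tau> \<Longrightarrow> permute_coords (\<sigma> \<circ> \<tau>) v = permute_coords \<sigma> (permute_coords \<tau> v)"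
  by (simp add: permute_coords_def vec_eq_iff o_inv_distrib)

lemma permute_coords_inv [simp]:
  assumes "bij \<sigma>"
  shows "permute_coords \<sigma> (permute_coords (inv_into UNIV \<sigma>) v) = v"
    "permute_coords (inv_into UNIV \<sigma>) (permute_coords \<sigma> v) = v"
  using assms by (simp_all add: permute_coords_def vec_eq_iff bij_is_inj bij_is_surj inv_inv_eq surj_f_inv_f)

lemma linear_permute_coords:
  "Vector_Spaces.linear (*s) (*s) (permute_coords \<sigma> :: ('k::field ^ 'n::finite) \<Rightarrow> _)"
  by (intro Vector_Spaces.linear_iff[THEN iffD2] conjI allI vec.vector_space_axioms)
    (simp_all add: permute_coords_def vec_eq_iff)

lemma inj_permute_coords: "bij \<sigma> \<Longrightarrow> inj (permute_coords \<sigma>)"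
  by (metis injI permute_coords_inv(2))

lemma permute_points_compose:
  "bij \<sigma> \<Longrightarrow> bij \<tau> \<Longrightarrow> permute_points (\<sigma> \<circ> \<tau>) L = permute_points \<sigma> (permute_points \<tau> L)"
  by (simp add: permute_points_def image_image permute_coords_compose)

lemma permute_points_id [simp]: "permute_points id L = L"
  by (simp add: permute_points_def permute_coords_def)

lemma permute_points_inv [simp]:
  assumes "bij \<sigma>"
  shows "permute_points \<sigma> (permute_points (inv_into UNIV \<sigma>) L) = L"
    "permute_points (inv_into UNIV \<sigma>) (permute_points \<sigma> L) = L"
  using assms by (simp_all add: permute_points_def image_image)

lemma carrier_BijGroup_UNIV: "carrier (BijGroup UNIV) = {\<sigma>. bij \<sigma>}"
  by (simp add: BijGroup_def Bij_def)

lemma mult_BijGroup_UNIV: "bij \<sigma> \<Longrightarrow> bij \<tau> \<Longrightarrow> \<sigma> \<otimes>\<^bsub>BijGroup UNIV\<^esub> \<tau> = \<sigma> \<circ> \<tau>"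
  by (simp add: BijGroup_def Bij_def compose_def fun_eq_iff)

lemma bij_permute_points:
  assumes "bij \<sigma>"
  shows "bij (permute_points \<sigma> :: ('k ^ 'n::finite) set set \<Rightarrow> _)"
  using assms
  by (intro bij_betw_byWitness[where f' = "permute_points (inv_into UNIV \<sigma>)"]) auto

lemma group_action_permute_points:
  "group_action (BijGroup (UNIV :: 'n::finite set)) UNIV
    (permute_points :: _ \<Rightarrow> ('k ^ 'n) set set \<Rightarrow> _)"
  by (intro group_action.intro group_hom.intro group_hom_axioms.intro group_BijGroup homI)
    (auto simp: carrier_BijGroup_UNIV mult_BijGroup_UNIV bij_permute_points
      permute_points_compose fun_eq_iff)

lemma order_BijGroup: "Coset.order (BijGroup (UNIV :: 'n::finite set)) = fact CARD('n)"
proof -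
  have "{\<sigma>. bij \<sigma>} = {\<sigma>. \<sigma> permutes (UNIV :: 'n set)}"
    by (auto simp: permutes_imp_bij intro: bij_imp_permutes)
  then show ?thesis
    by (simp add: Coset.order_def carrier_BijGroup_UNIV card_permutations)
qed

lemma permute_points_points_in:
  assumes "bij \<sigma>" "vec.subspace W"
  shows "permute_points \<sigma> (points_in W) = points_in (permute_coords \<sigma> ` W)"
  unfolding permute_points_def
  by (rule image_points_in[OF linear_permute_coords])
    (use assms inj_permute_coords[OF assms(1)] in \<open>auto intro: inj_on_subset\<close>)

text \<open>A bijection of the indices permutes the subsets of size d. This carries the vanishing of
  s_1 and of the quartic from \<ell> to every line of its orbit.\<close>

lemma mpoly_eval_elem_sym_permute:
  fixes v :: "'k::comm_ring_1 ^ 'n::finite"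
  assumes "bij \<sigma>"
  shows "mpoly_eval (elem_sym d) (permute_coords \<sigma> v) = mpoly_eval (elem_sym d) v"
proof -
  have ev: "mpoly_eval (elem_sym d) u = (\<Sum>A | card A = d. \<Prod>i\<in>A. u $ i)" for u :: "'k ^ 'n"
  proof -
    have "mpoly_eval (sum f A) u = (\<Sum>x\<in>A. mpoly_eval (f x) u)"
      for A and f :: "'n set \<Rightarrow> ('n, 'k) mpoly"
      by (induction A rule: infinite_finite_induct) (simp_all add: mpoly_eval_add)
    then show ?thesis by (simp add: elem_sym_def mpoly_eval_prod)
  qed
  have "(\<Sum>A | card A = d. \<Prod>i\<in>A. permute_coords \<sigma> v $ i) = (\<Sum>A | card A = d. \<Prod>i\<in>A. v $ i)"
  proof (rule sum.reindex_bij_witness[where i = "image \<sigma>" and j = "image (inv_into UNIV \<sigma>)"])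
    fix A :: "'n set"
    show "\<sigma> ` inv_into UNIV \<sigma> ` A = A" "inv_into UNIV \<sigma> ` \<sigma> ` A = A"
      using assms by (simp_all add: image_comp bij_is_inj bij_is_surj image_inv_f_f image_f_inv_f flip: image_comp)
    assume A: "A \<in> {A. card A = d}"
    have "inj \<sigma>" "inj (inv_into UNIV \<sigma>)" using assms by (simp_all add: bij_is_inj bij_imp_bij_inv)
    then show "\<sigma> ` A \<in> {A. card A = d}" "inv_into UNIV \<sigma> ` A \<in> {A. card A = d}"
      using A by (auto simp: card_image inj_on_subset)
    show "(\<Prod>i\<in>inv_into UNIV \<sigma> ` A. v $ i) = (\<Prod>i\<in>A. permute_coords \<sigma> v $ i)"
      using \<open>inj (inv_into UNIV \<sigma>)\<close> by (subst prod.reindex) (auto intro: inj_on_subset simp: permute_coords_def)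
  qed
  then show ?thesis by (simp only: ev)
qed

section \<open>The plane spanned by the line\<close>

definition plane :: "F2bar \<Rightarrow> (F2bar ^ 5) set" where
  "plane \<alpha> = {v. v$1 + v$2 + v$3 + v$4 + v$5 = 0 \<and>
     v$3 + v$2 + (\<alpha> ^ 3 + \<alpha> + 1) * v$1 = 0 \<and>
     v$4 + (\<alpha> ^ 3 + \<alpha> ^ 2 + \<alpha> + 1) * v$2 + \<alpha> * v$1 = 0}"

lemma line_l_eq: "line_l \<alpha> = points_in (plane \<alpha>)"
  unfolding line_l_def zero_locus_eq_points_in plane_def
  by (simp only: ball_simps mpoly_eval_elem_sym_1 mpoly_eval_simps mpoly_eval_Var mpoly_eval_Cst
      insert_iff empty_iff simp_thms ball_Un conj_assoc)

text \<open>The first two coordinates are the parameters; the fifth is the sum of the other four,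
  simplified in characteristic two.\<close>

definition plane_point :: "F2bar \<Rightarrow> F2bar \<Rightarrow> F2bar \<Rightarrow> F2bar ^ 5" where
  "plane_point \<alpha> x y = (\<chi> i. if i = 1 then x else if i = 2 then y
    else if i = 3 then (\<alpha> ^ 3 + \<alpha> + 1) * x + y
    else if i = 4 then \<alpha> * x + (\<alpha> ^ 3 + \<alpha> ^ 2 + \<alpha> + 1) * y
    else \<alpha> ^ 3 * x + (\<alpha> ^ 3 + \<alpha> ^ 2 + \<alpha> + 1) * y)"

lemma plane_point_nth [simp]:
  "plane_point \<alpha> x y $ 1 = x" "plane_point \<alpha> x y $ 2 = y"
  "plane_point \<alpha> x y $ 3 = (\<alpha> ^ 3 + \<alpha> + 1) * x + y"
  "plane_point \<alpha> x y $ 4 = \<alpha> * x + (\<alpha> ^ 3 + \<alpha> ^ 2 + \<alpha> + 1) * y"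
  "plane_point \<alpha> x y $ 5 = \<alpha> ^ 3 * x + (\<alpha> ^ 3 + \<alpha> ^ 2 + \<alpha> + 1) * y"
  by (simp_all add: plane_point_def)

lemma F2bar_add_eq_0D: "x + y = 0 \<Longrightarrow> x = y" for x y :: F2bar
  by (simp add: F2bar_add_eq_0_iff)

lemma plane_eq: "plane \<alpha> = {plane_point \<alpha> x y | x y. True}"
proof (intro equalityI subsetI)
  fix v assume v: "v \<in> plane \<alpha>"
  have 3: "v$3 = (\<alpha> ^ 3 + \<alpha> + 1) * v$1 + v$2"
    using v by (auto simp: plane_def add_ac dest!: F2bar_add_eq_0D)
  have 4: "v$4 = \<alpha> * v$1 + (\<alpha> ^ 3 + \<alpha> ^ 2 + \<alpha> + 1) * v$2"
    by (rule F2bar_add_eq_0D) (use v in \<open>simp add: plane_def add_ac\<close>)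
  have "v$5 = v$1 + v$2 + v$3 + v$4"
    by (rule F2bar_add_eq_0D) (use v in \<open>simp add: plane_def add_ac\<close>)
  then have 5: "v$5 = \<alpha> ^ 3 * v$1 + (\<alpha> ^ 3 + \<alpha> ^ 2 + \<alpha> + 1) * v$2"
    unfolding 3 4 by (simp add: F2bar_ring_simps)
  have "v = plane_point \<alpha> (v$1) (v$2)"
    by (simp add: vec_eq_iff forall_5 3 4 5)
  then show "v \<in> {plane_point \<alpha> x y | x y. True}" by blast
qed (auto simp: plane_def F2bar_ring_simps)

lemma plane_point_in_plane: "plane_point \<alpha> x y \<in> plane \<alpha>"
  by (auto simp: plane_eq)

lemma plane_eq_span: "plane \<alpha> = vec.span {plane_point \<alpha> 1 0, plane_point \<alpha> 0 1}"
proof -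
  have comb: "x *s plane_point \<alpha> 1 0 + y *s plane_point \<alpha> 0 1 = plane_point \<alpha> x y" for x y
    by (simp add: vec_eq_iff forall_5 F2bar_ring_simps)
  have "v \<in> vec.span {plane_point \<alpha> 1 0, plane_point \<alpha> 0 1} \<longleftrightarrow>
      (\<exists>x y. v = x *s plane_point \<alpha> 1 0 + y *s plane_point \<alpha> 0 1)" for v
    unfolding vec.span_insert vec.span_singleton
    by (auto simp: image_iff diff_eq_eq add.commute)
  then show ?thesis by (auto simp: plane_eq comb)
qed

lemma subspace_plane: "vec.subspace (plane \<alpha>)"
  by (simp add: plane_eq_span)

lemma dim_plane: "vec.dim (plane \<alpha>) = 2"
proof -
  have "plane_point \<alpha> 0 1 \<noteq> 0" "plane_point \<alpha> 1 0 \<notin> vec.span {plane_point \<alpha> 0 1}"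
    by (auto simp: vec.span_singleton vec_eq_iff forall_5)
  moreover from this(2) have "plane_point \<alpha> 1 0 \<noteq> plane_point \<alpha> 0 1"
    using vec.span_base by force
  ultimately show ?thesis
    unfolding plane_eq_span vec.dim_span
    by (subst vec.dim_eq_card_independent) (auto simp: vec.independent_insert)
qed

section \<open>The fifth root of unity\<close>

lemma F2bar_root_unity_exists: "\<exists>\<alpha> :: F2bar. \<alpha> ^ 4 + \<alpha> ^ 3 + \<alpha> ^ 2 + \<alpha> + 1 = 0"
proof -
  obtain \<alpha> :: F2bar where "(\<Sum>k\<le>4. 1 * \<alpha> ^ k) = 0"
    using alg_closed[of 4 "\<lambda>_. 1 :: F2bar"] by auto
  moreover have "{..4::nat} = {0, 1, 2, 3, 4}" by auto
  ultimately show ?thesis by (intro exI[of _ \<alpha>]) (simp add: add_ac)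
qed

lemma not_even_bool: "of_bool (p \<noteq> q) = (of_bool p + of_bool q :: F2bar)"
  by (cases p; cases q) simp_all

locale root_of_unity_5 =
  fixes \<alpha> :: F2bar
  assumes root: "\<alpha> ^ 4 + \<alpha> ^ 3 + \<alpha> ^ 2 + \<alpha> + 1 = 0"
begin

text \<open>The right-nested shape is what \<open>F2bar_ring_simps\<close> produces from powers;
  \<open>root_power4_left\<close> does the same in front of further factors. Together they reduce
  every polynomial in \<alpha> to degree below 4.\<close>

lemma root_power4: "\<alpha> * (\<alpha> * (\<alpha> * \<alpha>)) = 1 + (\<alpha> + (\<alpha> * \<alpha> + \<alpha> * (\<alpha> * \<alpha>)))"
  by (rule F2bar_add_eq_0D) (use root in \<open>simp add: F2bar_ring_simps\<close>)

lemma root_power4_left: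
  "\<alpha> * (\<alpha> * (\<alpha> * (\<alpha> * x))) = x + (\<alpha> * x + (\<alpha> * (\<alpha> * x) + \<alpha> * (\<alpha> * (\<alpha> * x))))"
proof -
  have "\<alpha> * (\<alpha> * (\<alpha> * \<alpha>)) * x = (1 + (\<alpha> + (\<alpha> * \<alpha> + \<alpha> * (\<alpha> * \<alpha>)))) * x"
    by (simp only: root_power4)
  then show ?thesis by (simp only: distrib_right mult.assoc mult_1)
qed

lemmas reduce = F2bar_ring_simps root_power4 root_power4_left

lemma root_power5: "\<alpha> ^ 5 = 1"
  by (simp add: eval_nat_numeral reduce)

lemma root_in_Fq: "\<alpha> \<in> Fq 16"
proof -
  have "\<alpha> ^ 16 = (\<alpha> ^ 5) ^ 3 * \<alpha>" by (simp flip: power_mult power_Suc2)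
  then show ?thesis by (simp add: Fq_def root_power5)
qed

text \<open>Since \<alpha>^4 = 1 + \<alpha> + \<alpha>^2 + \<alpha>^3 and \<alpha>^5 = 1, this is
  \<alpha> + \<alpha>^4 = \<alpha> + 1/\<alpha>, the trace of \<alpha> from F_16 to F_4.\<close>

definition \<mu> :: F2bar where "\<mu> = 1 + \<alpha> ^ 2 + \<alpha> ^ 3"

text \<open>Nonvanishing, order three and membership in \<open>Fq 4\<close> all follow from this
  relation.\<close>

lemma \<mu>_square: "\<mu> ^ 2 = \<mu> + 1"
  by (simp add: \<mu>_def reduce)

lemma \<mu>_nonzero: "\<mu> \<noteq> 0"
  using \<mu>_square by auto

lemma \<mu>_cube: "\<mu> ^ 3 = 1"
proof -
  have "\<mu> ^ 3 = \<mu> ^ 2 * \<mu>" by (simp add: power3_eq_cube power2_eq_square)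
  also have "\<dots> = \<mu> ^ 2 + \<mu>" unfolding \<mu>_square by (simp add: F2bar_ring_simps \<mu>_square[unfolded power2_eq_square])
  finally show ?thesis by (simp add: \<mu>_square add_ac)
qed

lemma primitive_\<mu>: "primitive_root_of_unity 3 \<mu>"
proof -
  have "\<mu> \<noteq> 1" "\<mu>\<^sup>2 \<noteq> 1" using \<mu>_square \<mu>_nonzero by auto
  moreover have "{0<..<3} = {1, 2 :: nat}" by auto
  ultimately have "\<forall>k\<in>{0<..<3}. \<mu> ^ k \<noteq> 1" by simp
  then show ?thesis by (simp add: primitive_root_of_unity_def \<mu>_cube)
qed

lemma \<mu>_in_Fq: "\<mu> \<in> Fq 4"
  using \<mu>_cube by (simp add: Fq_def power4_eq_xxxx power3_eq_cube)

lemma quartic_on_plane: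
  assumes "v \<in> plane \<alpha>"
  shows "e4 v + \<mu> * (e2 v)\<^sup>2 = 0"
proof -
  obtain x y where v: "v = plane_point \<alpha> x y" using assms by (auto simp: plane_eq)
  \<comment> \<open>On the plane s_4 has only even exponents, as has the square of s_2 in
    characteristic two. Hence only the coefficients of x^4, x^2 y^2 and y^4 have to match.\<close>
  have 2: "e2 v = \<alpha> * x\<^sup>2 + (\<alpha> + \<alpha>\<^sup>2 + \<alpha> ^ 3) * x * y + (1 + \<alpha> ^ 3) * y\<^sup>2"
    by (simp add: e2_def v reduce)
  have 4: "e4 v = (\<alpha> + \<alpha> ^ 3) * x ^ 4 + (\<alpha> + \<alpha>\<^sup>2) * x\<^sup>2 * y\<^sup>2 + \<alpha> ^ 3 * y ^ 4"
    by (simp add: e4_def v reduce)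
  show ?thesis unfolding 2 4 \<mu>_def by (simp add: reduce)
qed

end

section \<open>The stabilizer of the line\<close>

text \<open>The quadruple \<open>(p, q, r, s)\<close> encodes \<open>p + q\<alpha> + r\<alpha>\<^sup>2 + s\<alpha>\<^sup>3\<close>; products are
  reduced by \<open>\<alpha>\<^sup>4 = 1 + \<alpha> + \<alpha>\<^sup>2 + \<alpha>\<^sup>3\<close>, \<open>\<alpha>\<^sup>5 = 1\<close> and \<open>\<alpha>\<^sup>6 = \<alpha>\<close>. This makes the equations
  of the plane decidable at permuted basis vectors.\<close>

type_synonym bits = "bool \<times> bool \<times> bool \<times> bool"

fun bits_add :: "bits \<Rightarrow> bits \<Rightarrow> bits" where
  "bits_add (p, q, r, s) (p', q', r', s') = (p \<noteq> p', q \<noteq> q', r \<noteq> r', s \<noteq> s')"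

fun bits_mult :: "bits \<Rightarrow> bits \<Rightarrow> bits" where
  "bits_mult (p, q, r, s) (p', q', r', s') =
    (let c4 = ((q \<and> s') \<noteq> ((r \<and> r') \<noteq> (s \<and> q')));
         c5 = ((r \<and> s') \<noteq> (s \<and> r'));
         c6 = (s \<and> s')
     in ((p \<and> p') \<noteq> (c4 \<noteq> c5),
         ((p \<and> q') \<noteq> (q \<and> p')) \<noteq> (c4 \<noteq> c6),
         ((p \<and> r') \<noteq> ((q \<and> q') \<noteq> (r \<and> p'))) \<noteq> c4,
         (((p \<and> s') \<noteq> (q \<and> r')) \<noteq> ((r \<and> q') \<noteq> (s \<and> p'))) \<noteq> c4))"

abbreviation "bits_0 \<equiv> (False, False, False, False)"
abbreviation "bits_1 \<equiv> (True, False, False, False)"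

text \<open>A check of all 16 elements, playing the role of irreducibility of 1 + X + X^2 + X^3 +
  X^4 over F_2. Inverses force a multiplicative map into a field to be nonzero on nonzero elements,
  which is how \<open>bits_value_eq_0\<close> is obtained.\<close>

lemma bits_mult_inverse: "x \<noteq> bits_0 \<Longrightarrow> \<exists>y. bits_mult x y = bits_1"
proof -
  have "\<forall>p q r s. (p, q, r, s) \<noteq> bits_0 \<longrightarrow>
      (\<exists>p' q' r' s'. bits_mult (p, q, r, s) (p', q', r', s') = bits_1)"
    by (simp add: all_bool_eq ex_bool_eq)
  then show "x \<noteq> bits_0 \<Longrightarrow> ?thesis" by (cases x) metis
qed

text \<open>The encoded basis vectors of the plane: \<open>plane_point \<alpha> 1 0\<close> here,
  \<open>plane_point \<alpha> 0 1\<close> in \<open>plane_bits2\<close>.\<close>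

definition plane_bits1 :: "5 \<Rightarrow> bits" where
  "plane_bits1 i = (if i = 1 then bits_1 else if i = 2 then bits_0
    else if i = 3 then (True, True, False, True)
    else if i = 4 then (False, True, False, False) else (False, False, False, True))"

definition plane_bits2 :: "5 \<Rightarrow> bits" where
  "plane_bits2 i = (if i = 1 then bits_0 else if i = 2 \<or> i = 3 then bits_1
    else (True, True, True, True))"

text \<open>The equations of the plane for a rearranged vector: \<open>i\<close> and
  \<open>j\<close> are the sources of x_1 and x_2, while \<open>k\<close> is the source of x_3 here
  and of x_4 in \<open>plane_eqn2\<close>.\<close>

definition plane_eqn1 :: "(5 \<Rightarrow> bits) \<Rightarrow> 5 \<Rightarrow> 5 \<Rightarrow> 5 \<Rightarrow> bool" where
  "plane_eqn1 t i j k \<longleftrightarrow>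
    bits_add (bits_add (t k) (t j)) (bits_mult (True, True, False, True) (t i)) = bits_0"

definition plane_eqn2 :: "(5 \<Rightarrow> bits) \<Rightarrow> 5 \<Rightarrow> 5 \<Rightarrow> 5 \<Rightarrow> bool" where
  "plane_eqn2 t i j k \<longleftrightarrow>
    bits_add (bits_add (t k) (bits_mult (True, True, True, True) (t j)))
      (bits_mult (False, True, False, False) (t i)) = bits_0"

text \<open>The equation in x_1, x_2, x_3 already cuts the injective triples down to two; the other
  equation then fixes the source of x_4, and x_5 takes what is left. No list of 120 permutations is
  needed.\<close>

lemma plane_eqn1_solutions:
  "\<forall>i j k. i \<noteq> j \<longrightarrow> i \<noteq> k \<longrightarrow> j \<noteq> k \<longrightarrow> plane_eqn1 plane_bits1 i j k \<longrightarrow> plane_eqn1 plane_bits2 i j k \<longrightarrow>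
    (i, j, k) \<in> {(1, 2, 3), (1, 3, 2)}"
  by (simp add: forall_5 plane_eqn1_def plane_bits1_def plane_bits2_def)

lemma plane_eqn2_solutions:
  "\<forall>l. plane_eqn2 plane_bits1 1 2 l \<longrightarrow> plane_eqn2 plane_bits2 1 2 l \<longrightarrow> l = 4"
  "\<forall>l. plane_eqn2 plane_bits1 1 3 l \<longrightarrow> plane_eqn2 plane_bits2 1 3 l \<longrightarrow> l = 5"
  by (simp_all add: forall_5 plane_eqn2_def plane_bits1_def plane_bits2_def)

definition double_swap :: "5 \<Rightarrow> 5" where
  "double_swap i = (if i = 2 then 3 else if i = 3 then 2 else if i = 4 then 5 else if i = 5 then 4 else i)"

lemma double_swap_simps [simp]:
  "double_swap 1 = 1" "double_swap 2 = 3" "double_swap 3 = 2" "double_swap 4 = 5" "double_swap 5 = 4"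
  by (simp_all add: double_swap_def)

lemma double_swap_double_swap: "double_swap \<circ> double_swap = id"
  by (simp add: fun_eq_iff forall_5)

lemma bij_double_swap: "bij double_swap"
  using double_swap_double_swap o_bij by blast

context root_of_unity_5
begin

definition bits_value :: "bits \<Rightarrow> F2bar" where
  "bits_value = (\<lambda>(p, q, r, s).
    of_bool p + of_bool q * \<alpha> + of_bool r * \<alpha>\<^sup>2 + of_bool s * \<alpha> ^ 3)"

lemma bits_value_add: "bits_value (bits_add x y) = bits_value x + bits_value y"
  by (cases x; cases y) (simp add: bits_value_def not_even_bool F2bar_ring_simps)

lemma bits_value_mult: "bits_value (bits_mult x y) = bits_value x * bits_value y"
  by (cases x; cases y)
    (simp add: bits_value_def not_even_bool of_bool_conj Let_def reduce)

lemma bits_value_eq_0: "bits_value x = 0 \<Longrightarrow> x = bits_0"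
proof (rule ccontr)
  assume x: "bits_value x = 0" "x \<noteq> bits_0"
  then obtain y where "bits_mult x y = bits_1" using bits_mult_inverse by blast
  then have "bits_value x * bits_value y = bits_value bits_1"
    by (metis bits_value_mult)
  then have "bits_value x * bits_value y = 1"
    by (simp add: bits_value_def)
  with x show False by simp
qed

lemma plane_point_bits:
  "plane_point \<alpha> 1 0 $ i = bits_value (plane_bits1 i)"
  "plane_point \<alpha> 0 1 $ i = bits_value (plane_bits2 i)"
  using exhaust_5[of i]
  by (auto simp: plane_point_def bits_value_def plane_bits1_def plane_bits2_def add_ac)

lemma bits_in_planeD:
  assumes "\<And>i. v $ i = bits_value (t (\<pi> i))" "v \<in> plane \<alpha>"
  shows "plane_eqn1 t (\<pi> 1) (\<pi> 2) (\<pi> 3)" "plane_eqn2 t (\<pi> 1) (\<pi> 2) (\<pi> 4)"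
proof -
  have 1: "bits_value (True, True, False, True) = \<alpha> ^ 3 + \<alpha> + 1"
    "bits_value (True, True, True, True) = \<alpha> ^ 3 + \<alpha>\<^sup>2 + \<alpha> + 1"
    "bits_value (False, True, False, False) = \<alpha>"
    by (simp_all add: bits_value_def add_ac)
  show "plane_eqn1 t (\<pi> 1) (\<pi> 2) (\<pi> 3)" "plane_eqn2 t (\<pi> 1) (\<pi> 2) (\<pi> 4)"
    unfolding plane_eqn1_def plane_eqn2_def
    using assms by (auto intro!: bits_value_eq_0 simp: bits_value_add bits_value_mult 1 plane_def)
qed

text \<open>Invariance is tested on the two basis vectors only. Coordinate i of a permuted vector is
  coordinate \<pi> i of the original, where \<pi> is the inverse of \<sigma>, so the finite search
  is for \<pi>.\<close>

lemma permute_plane_imp: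
  assumes \<sigma>: "bij \<sigma>" and eq: "permute_coords \<sigma> ` plane \<alpha> = plane \<alpha>"
  shows "\<sigma> = id \<or> \<sigma> = double_swap"
proof -
  define \<pi> where "\<pi> = inv_into UNIV \<sigma>"
  have \<pi>: "inj \<pi>" "\<sigma> (\<pi> i) = i" for i
    using \<sigma> unfolding \<pi>_def by (simp_all add: bij_imp_bij_inv bij_is_inj bij_is_surj surj_f_inv_f)
  have mem: "permute_coords \<sigma> (plane_point \<alpha> 1 0) \<in> plane \<alpha>" "permute_coords \<sigma> (plane_point \<alpha> 0 1) \<in> plane \<alpha>"
    using eq plane_point_in_plane by blast+
  have nth: "permute_coords \<sigma> (plane_point \<alpha> 1 0) $ i = bits_value (plane_bits1 (\<pi> i))"
    "permute_coords \<sigma> (plane_point \<alpha> 0 1) $ i = bits_value (plane_bits2 (\<pi> i))" for i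
    by (simp_all add: permute_coords_def \<pi>_def plane_point_bits)
  have e: "plane_eqn1 plane_bits1 (\<pi> 1) (\<pi> 2) (\<pi> 3)" "plane_eqn2 plane_bits1 (\<pi> 1) (\<pi> 2) (\<pi> 4)"
    "plane_eqn1 plane_bits2 (\<pi> 1) (\<pi> 2) (\<pi> 3)" "plane_eqn2 plane_bits2 (\<pi> 1) (\<pi> 2) (\<pi> 4)"
    using bits_in_planeD[where \<pi> = \<pi>, OF nth(1) mem(1)] bits_in_planeD[where \<pi> = \<pi>, OF nth(2) mem(2)]
    by simp_all
  have d: "\<pi> i \<noteq> \<pi> j" if "i \<noteq> j" for i j using \<pi>(1) that by (simp add: inj_eq)
  have "(\<pi> 1 = 1 \<and> \<pi> 2 = 2 \<and> \<pi> 3 = 3) \<or> (\<pi> 1 = 1 \<and> \<pi> 2 = 3 \<and> \<pi> 3 = 2)"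
    using plane_eqn1_solutions e(1,3) d by simp
  then consider "\<pi> 1 = 1" "\<pi> 2 = 2" "\<pi> 3 = 3" "\<pi> 4 = 4" | "\<pi> 1 = 1" "\<pi> 2 = 3" "\<pi> 3 = 2" "\<pi> 4 = 5"
    using e(2,4) plane_eqn2_solutions by metis
  then show ?thesis
  proof cases
    case 1
    then have "\<pi> 5 = 5"
      using exhaust_5[of "\<pi> 5"] d[of 5 1] d[of 5 2] d[of 5 3] d[of 5 4] by auto
    then have "\<sigma> i = i" for i
      using 1 \<pi>(2) exhaust_5[of i] by metis
    then show ?thesis by auto
  next
    case 2
    then have "\<pi> 5 = 4"
      using exhaust_5[of "\<pi> 5"] d[of 5 1] d[of 5 2] d[of 5 3] d[of 5 4] by auto
    then have "\<sigma> i = double_swap i" for i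
      using 2 \<pi>(2) exhaust_5[of i] double_swap_simps by metis
    then show ?thesis by auto
  qed
qed

lemma double_swap_plane: "permute_coords double_swap ` plane \<alpha> = plane \<alpha>"
proof -
  have inv: "inv_into UNIV double_swap = double_swap"
    using double_swap_double_swap by (simp add: inv_unique_comp)
  have sub: "permute_coords double_swap v \<in> plane \<alpha>" if "v \<in> plane \<alpha>" for v
  proof -
    obtain x y where v: "v = plane_point \<alpha> x y" using \<open>v \<in> plane \<alpha>\<close> by (auto simp: plane_eq)
    show ?thesis unfolding v by (simp add: plane_def permute_coords_def inv reduce)
  qed
  \<comment> \<open>For an involution one inclusion gives equality.\<close>
  have "permute_coords double_swap (permute_coords double_swap v) = v" for v :: "F2bar ^ 5"
    using permute_coords_inv(1)[OF bij_double_swap, of v] by (simp add: inv)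
  then show ?thesis using sub by (metis image_eqI image_subsetI subsetI subset_antisym)
qed

lemma stabilizer_line_l: "stabilizer (BijGroup UNIV) permute_points (line_l \<alpha>) = {id, double_swap}"
proof -
  have "permute_points \<sigma> (line_l \<alpha>) = line_l \<alpha> \<longleftrightarrow> permute_coords \<sigma> ` plane \<alpha> = plane \<alpha>"
    if "bij \<sigma>" for \<sigma>
    using that by (simp add: line_l_eq permute_points_points_in subspace_plane points_in_inject
      vec.linear_subspace_image[OF linear_permute_coords])
  then show ?thesis
    using double_swap_plane bij_double_swap
    by (auto simp: stabilizer_def carrier_BijGroup_UNIV dest: permute_plane_imp)
qed

lemma card_line_orbit: "card (line_orbit \<alpha>) = 60"
proof -
  have "id \<noteq> double_swap"
  proof
    assume "id = double_swap"
    then have "id 2 = double_swap 2" by (rule fun_cong)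
    then show False by simp
  qed
  then have "card (stabilizer (BijGroup UNIV) permute_points (line_l \<alpha>)) = 2"
    by (simp add: stabilizer_line_l)
  then show ?thesis
    using group_action.orbit_stabilizer_theorem[OF group_action_permute_points, of "line_l \<alpha>"]
    by (simp add: line_orbit_def order_BijGroup fact_numeral)
qed

end

section \<open>Lines in projective 3-space\<close>

definition drop_coord5 :: "F2bar ^ 5 \<Rightarrow> F2bar ^ 4" where
  "drop_coord5 v = (\<chi> i. if i = 1 then v$1 else if i = 2 then v$2 else if i = 3 then v$3 else v$4)"

lemma drop_coord5_nth [simp]:
  "drop_coord5 v $ 1 = v$1" "drop_coord5 v $ 2 = v$2" "drop_coord5 v $ 3 = v$3" "drop_coord5 v $ 4 = v$4"
  by (simp_all add: drop_coord5_def)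

lemma linear_drop_coord5: "Vector_Spaces.linear (*s) (*s) drop_coord5"
  by (intro Vector_Spaces.linear_iff[THEN iffD2] conjI allI vec.vector_space_axioms)
    (simp_all add: vec_eq_iff forall_4)

lemma drop_lift [simp]: "drop_coord5 (lift_hyperplane w) = w"
  by (simp add: vec_eq_iff forall_4)

lemma lift_drop:
  assumes "mpoly_eval (elem_sym 1) v = 0"
  shows "lift_hyperplane (drop_coord5 v) = v"
proof -
  have "v$1 + v$2 + v$3 + v$4 = v$5"
    by (rule F2bar_add_eq_0D) (use assms in \<open>simp only: mpoly_eval_elem_sym_1\<close>)
  then show ?thesis by (simp add: vec_eq_iff forall_5)
qed

definition drop_line :: "(F2bar ^ 5) set set \<Rightarrow> (F2bar ^ 4) set set" where
  "drop_line L = image drop_coord5 ` L"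

lemma line_orbitE:
  assumes "L \<in> line_orbit \<alpha>"
  obtains \<sigma> where "bij \<sigma>" "L = points_in (permute_coords \<sigma> ` plane \<alpha>)"
  using assms
  by (auto simp: line_orbit_def orbit_def carrier_BijGroup_UNIV line_l_eq
      permute_points_points_in subspace_plane)

lemma subspace_permute_plane: "vec.subspace (permute_coords \<sigma> ` plane \<alpha>)"
  by (rule vec.linear_subspace_image[OF linear_permute_coords subspace_plane])

lemma dim_permute_plane:
  assumes "bij \<sigma>"
  shows "vec.dim (permute_coords \<sigma> ` plane \<alpha>) = 2"
  using vec.dim_image_eq[OF linear_permute_coords] inj_permute_coords[OF assms] dim_plane
  by (metis inj_on_subset subset_UNIV)

lemma elem_sym_1_permute_plane:
  assumes "bij \<sigma>" "v \<in> permute_coords \<sigma> ` plane \<alpha>"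
  shows "mpoly_eval (elem_sym 1) v = 0"
proof -
  obtain u where u: "u \<in> plane \<alpha>" "v = permute_coords \<sigma> u" using assms(2) by blast
  have "mpoly_eval (elem_sym 1) u = 0" using u(1) by (simp add: mpoly_eval_elem_sym_1 plane_def del: One_nat_def)
  then show ?thesis unfolding u(2) mpoly_eval_elem_sym_permute[OF assms(1)] .
qed

lemma is_line_line_orbit: "L \<in> line_orbit \<alpha> \<Longrightarrow> is_line L"
  by (elim line_orbitE)
    (simp add: subspace_imp_is_line subspace_permute_plane dim_permute_plane)

lemma inj_on_drop_coord5: "bij \<sigma> \<Longrightarrow> inj_on drop_coord5 (permute_coords \<sigma> ` plane \<alpha>)"
  using elem_sym_1_permute_plane lift_drop by (metis inj_onI)

lemma drop_line_points_in:
  assumes "bij \<sigma>"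
  shows "drop_line (points_in (permute_coords \<sigma> ` plane \<alpha>)) =
    points_in (drop_coord5 ` permute_coords \<sigma> ` plane \<alpha>)"
  unfolding drop_line_def
  by (rule image_points_in[OF linear_drop_coord5 inj_on_drop_coord5[OF assms] subspace_permute_plane])

lemma inj_on_drop_line: "inj_on drop_line (line_orbit \<alpha>)"
proof (rule inj_on_inverseI[where g = "image (image lift_hyperplane)"])
  fix L assume "L \<in> line_orbit \<alpha>"
  then obtain \<sigma> where \<sigma>: "bij \<sigma>" "L = points_in (permute_coords \<sigma> ` plane \<alpha>)"
    by (rule line_orbitE)
  have "lift_hyperplane ` drop_coord5 ` P = P" if "P \<in> L" for P
  proof -
    have "P \<subseteq> permute_coords \<sigma> ` plane \<alpha>" using that by (simp add: \<sigma>(2) points_in_def)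
    then have "lift_hyperplane (drop_coord5 v) = v" if "v \<in> P" for v
      using that elem_sym_1_permute_plane[OF \<sigma>(1)] lift_drop by blast
    then show ?thesis by (simp add: image_image)
  qed
  then show "image (image lift_hyperplane) (drop_line L) = L"
    by (simp add: drop_line_def image_image)
qed

text \<open>Turns the projected plane from an image into a preimage under the inverse map, so that
  it acquires equations, as \<open>line_over\<close> demands, and inherits the vanishing of the
  quartic.\<close>

lemma mem_drop_plane_iff:
  assumes "bij \<sigma>"
  shows "w \<in> drop_coord5 ` permute_coords \<sigma> ` plane \<alpha> \<longleftrightarrow>
    permute_coords (inv_into UNIV \<sigma>) (lift_hyperplane w) \<in> plane \<alpha>" (is "?L \<longleftrightarrow> ?R")
proof
  assume ?L
  then obtain u where u: "u \<in> plane \<alpha>" "w = drop_coord5 (permute_coords \<sigma> u)" by blast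
  then have "lift_hyperplane w = permute_coords \<sigma> u"
    using lift_drop elem_sym_1_permute_plane[OF assms] by blast
  then show ?R using u(1) assms by simp
next
  assume ?R
  moreover have "w = drop_coord5 (permute_coords \<sigma> (permute_coords (inv_into UNIV \<sigma>) (lift_hyperplane w)))"
    using assms by simp
  ultimately show ?L by blast
qed

lemma line_over_drop_line:
  assumes \<alpha>: "\<alpha> \<in> Fq 16" and L: "L \<in> line_orbit \<alpha>"
  shows "line_over (Fq 16) (drop_line L)"
proof -
  obtain \<sigma> where \<sigma>: "bij \<sigma>" "L = points_in (permute_coords \<sigma> ` plane \<alpha>)"
    using L by (rule line_orbitE)
  have "is_line (drop_line L)"
    unfolding \<sigma>(2) drop_line_points_in[OF \<sigma>(1)]
    by (rule linear_image_is_line[OF linear_drop_coord5 inj_on_drop_coord5[OF \<sigma>(1)]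
      subspace_permute_plane dim_permute_plane[OF \<sigma>(1)]])
  moreover
  \<comment> \<open>Undoing \<sigma> on a lifted point puts coordinate \<sigma> i in position i.
    Thus \<open>?p\<close> and \<open>?q\<close> are the two equations of \<ell> beyond s_1 = 0,
    pulled back to P^3; lifts satisfy s_1 = 0 by construction.\<close>
  let ?h = "\<lambda>i. hyperplane_coords (\<sigma> i)"
  let ?p = "?h 3 + ?h 2 + Cst (\<alpha> ^ 3 + \<alpha> + 1) * ?h 1"
  let ?q = "?h 4 + Cst (\<alpha> ^ 3 + \<alpha> ^ 2 + \<alpha> + 1) * ?h 2 + Cst \<alpha> * ?h 1"
  have sub: "is_subring (Fq 16)" using is_subring_Fq[of 4] by simp
  have pow: "x ^ n \<in> Fq 16" if "x \<in> Fq 16" for x n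
    using sub that by (induction n) (simp_all add: is_subring_def)
  have C: "homogeneous 1 (Cst c * p)" if "homogeneous 1 p" for c and p :: "(4, F2bar) mpoly"
    using homogeneous_mult[OF homogeneous_Cst that] by simp
  have "\<forall>p\<in>{?p, ?q}. homogeneous 1 p \<and> coeffs_in (Fq 16) p"
  proof (intro ballI)
    fix p assume "p \<in> {?p, ?q}"
    then consider "p = ?p" | "p = ?q" by blast
    then show "homogeneous 1 p \<and> coeffs_in (Fq 16) p"
    proof cases
      case 1
      have "\<alpha> ^ 3 + \<alpha> + 1 \<in> Fq 16" using sub pow[OF \<alpha>] \<alpha> by (simp add: is_subring_def)
      then show ?thesis unfolding 1
        by (intro conjI homogeneous_add C homogeneous_hyperplane_coords coeffs_in_add[OF sub]
          coeffs_in_mult[OF sub] coeffs_in_Cst[OF sub] coeffs_in_hyperplane_coords[OF sub])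
    next
      case 2
      have "\<alpha> ^ 3 + \<alpha> ^ 2 + \<alpha> + 1 \<in> Fq 16" using sub pow[OF \<alpha>] \<alpha> by (simp add: is_subring_def)
      then show ?thesis unfolding 2 using \<alpha>
        by (intro conjI homogeneous_add C homogeneous_hyperplane_coords coeffs_in_add[OF sub]
          coeffs_in_mult[OF sub] coeffs_in_Cst[OF sub] coeffs_in_hyperplane_coords[OF sub])
    qed
  qed
  moreover have "drop_line L = zero_locus {?p, ?q}"
  proof -
    have "permute_coords (inv_into UNIV \<sigma>) (lift_hyperplane w) \<in> plane \<alpha> \<longleftrightarrow>
        (\<forall>p\<in>{?p, ?q}. mpoly_eval p w = 0)" for w
    proof -
      have "mpoly_eval (elem_sym 1) (lift_hyperplane w) = 0"
        unfolding mpoly_eval_elem_sym_1 by (simp add: add_ac)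
      then have "mpoly_eval (elem_sym 1) (permute_coords (inv_into UNIV \<sigma>) (lift_hyperplane w)) = 0"
        using mpoly_eval_elem_sym_permute[OF bij_imp_bij_inv[OF \<sigma>(1)]] by metis
      moreover have "permute_coords (inv_into UNIV \<sigma>) (lift_hyperplane w) $ i = mpoly_eval (?h i) w" for i
        using \<sigma>(1) by (simp add: permute_coords_def inv_inv_eq lift_hyperplane_def)
      ultimately show ?thesis
        by (simp add: plane_def mpoly_eval_elem_sym_1 mpoly_eval_simps del: One_nat_def)
    qed
    then show ?thesis
      unfolding \<sigma>(2) drop_line_points_in[OF \<sigma>(1)] zero_locus_eq_points_in
      using mem_drop_plane_iff[OF \<sigma>(1)] by (intro arg_cong[where f = points_in]) blast
  qed
  ultimately show ?thesis unfolding line_over_def by blast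
qed

lemma mpoly_eval_S_quartic_permute:
  "bij \<sigma> \<Longrightarrow> mpoly_eval (S_quartic \<mu>) (permute_coords \<sigma> v) = mpoly_eval (S_quartic \<mu>) v"
  by (simp add: S_quartic_def mpoly_eval_simps mpoly_eval_elem_sym_permute)

context root_of_unity_5
begin

lemma line_l_subset_S_surface: "line_l \<alpha> \<subseteq> S_surface \<mu>"
proof -
  have "mpoly_eval p v = 0" if "v \<in> plane \<alpha>" "p \<in> S_eqs \<mu>" for p v
    using that quartic_on_plane[of v] mpoly_eval_elem_sym_1[of v] mpoly_eval_S_quartic[of \<mu> v]
    by (auto simp: S_eqs_def plane_def)
  then show ?thesis
    unfolding line_l_eq S_surface_def zero_locus_eq_points_in by (auto simp: points_in_def)
qed

lemma drop_line_subset_quartic: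
  assumes L: "L \<in> line_orbit \<alpha>"
  shows "drop_line L \<subseteq> zero_locus {S_quartic_P3 \<mu>}"
proof -
  obtain \<sigma> where \<sigma>: "bij \<sigma>" "L = points_in (permute_coords \<sigma> ` plane \<alpha>)"
    using L by (rule line_orbitE)
  have "mpoly_eval (S_quartic_P3 \<mu>) w = 0" if "w \<in> drop_coord5 ` permute_coords \<sigma> ` plane \<alpha>" for w
  proof -
    have "permute_coords (inv_into UNIV \<sigma>) (lift_hyperplane w) \<in> plane \<alpha>"
      using that mem_drop_plane_iff[OF \<sigma>(1)] by blast
    from quartic_on_plane[OF this] show ?thesis
      using mpoly_eval_S_quartic_permute[OF bij_imp_bij_inv[OF \<sigma>(1)], of \<mu> "lift_hyperplane w"]
      by (simp add: mpoly_eval_S_quartic_P3 mpoly_eval_S_quartic)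
  qed
  then show ?thesis
    unfolding \<sigma>(2) drop_line_points_in[OF \<sigma>(1)] zero_locus_eq_points_in
    by (auto simp: points_in_def)
qed

lemma is_line_line_l: "is_line (line_l \<alpha>)"
  by (simp add: line_l_eq subspace_imp_is_line subspace_plane dim_plane)

end

theorem mainTheorem2:
  shows
    "(\<forall>\<alpha> \<in> Fq 16. \<forall>\<mu>0.
        \<alpha> ^ 4 + \<alpha> ^ 3 + \<alpha> ^ 2 + \<alpha> + 1 = 0 \<longrightarrow> \<mu>0 = 1 + \<alpha> ^ 2 + \<alpha> ^ 3 \<longrightarrow>
        primitive_root_of_unity 3 \<mu>0 \<and>
        (\<forall>p\<in>S_eqs \<mu>0. coeffs_in (Fq 4) p) \<and>
        smooth_of_dim 2 (S_eqs \<mu>0) \<and>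
        smooth_quartic_surface (S_quartic_P3 \<mu>0) \<and>
        is_line (line_l \<alpha>) \<and> line_l \<alpha> \<subseteq> S_surface \<mu>0 \<and>
        (\<forall>L\<in>line_orbit \<alpha>. is_line L) \<and> card (line_orbit \<alpha>) = 60) \<and>
     (\<exists>f :: (4, F2bar) mpoly. smooth_quartic_surface f \<and> coeffs_in (Fq 4) f \<and>
        (\<exists>\<L>. card \<L> = 60 \<and> (\<forall>L\<in>\<L>. line_over (Fq 16) L \<and> L \<subseteq> zero_locus {f})))"
proof (intro conjI ballI allI impI)
  have sub: "is_subring (Fq 4)" using is_subring_Fq[of 2] by simp
  {
    fix \<alpha> \<mu>0 :: F2bar
    assume "\<alpha> ^ 4 + \<alpha> ^ 3 + \<alpha> ^ 2 + \<alpha> + 1 = 0" and \<mu>0: "\<mu>0 = 1 + \<alpha> ^ 2 + \<alpha> ^ 3"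
    then interpret root_of_unity_5 \<alpha> by unfold_locales
    have \<mu>0: "\<mu>0 = \<mu>" by (simp add: \<mu>0 \<mu>_def)
    show "primitive_root_of_unity 3 \<mu>0" unfolding \<mu>0 by (rule primitive_\<mu>)
    show "coeffs_in (Fq 4) p" if "p \<in> S_eqs \<mu>0" for p
      using coeffs_in_S_eqs[OF sub \<mu>_in_Fq] that \<mu>0 by simp
    show "smooth_of_dim 2 (S_eqs \<mu>0)" "smooth_quartic_surface (S_quartic_P3 \<mu>0)"
      unfolding \<mu>0 using smooth_S_eqs[OF \<mu>_nonzero] smooth_quartic_surface_S_quartic_P3[OF \<mu>_nonzero]
      by blast+
    show "is_line (line_l \<alpha>)" by (rule is_line_line_l)
    show "line_l \<alpha> \<subseteq> S_surface \<mu>0" unfolding \<mu>0 by (rule line_l_subset_S_surface)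
    show "is_line L" if "L \<in> line_orbit \<alpha>" for L using that by (rule is_line_line_orbit)
    show "card (line_orbit \<alpha>) = 60" by (rule card_line_orbit)
  }
  obtain \<alpha> :: F2bar where "\<alpha> ^ 4 + \<alpha> ^ 3 + \<alpha> ^ 2 + \<alpha> + 1 = 0"
    using F2bar_root_unity_exists by blast
  then interpret root_of_unity_5 \<alpha> by unfold_locales
  \<comment> \<open>The 60 lines in P^3 are the projected orbit; they stay distinct because lifting
    to the hyperplane recovers each line.\<close>
  have "card (drop_line ` line_orbit \<alpha>) = 60"
    by (simp add: card_image[OF inj_on_drop_line] card_line_orbit)
  moreover have "\<forall>L\<in>drop_line ` line_orbit \<alpha>. line_over (Fq 16) L \<and> L \<subseteq> zero_locus {S_quartic_P3 \<mu>}"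
    using line_over_drop_line[OF root_in_Fq] drop_line_subset_quartic by blast
  ultimately show "\<exists>f :: (4, F2bar) mpoly. smooth_quartic_surface f \<and> coeffs_in (Fq 4) f \<and>
        (\<exists>\<L>. card \<L> = 60 \<and> (\<forall>L\<in>\<L>. line_over (Fq 16) L \<and> L \<subseteq> zero_locus {f}))"
    using smooth_quartic_surface_S_quartic_P3[OF \<mu>_nonzero] coeffs_in_S_quartic_P3[OF sub \<mu>_in_Fq]
    by blast
qed

end
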